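(* Let $k$ be a power of $2$ and $1/\varepsilon^2$ an integer. Let $\Pi$ be the transcript of any randomized blackboard protocol for $k$-BTX on input distribution $\nu$ with error probability $\delta$, for a sufficiently small constant $\delta$. Then $I(X,Y;\Pi\mid M,D)=\Omega(1/\varepsilon^2)$, where the information is measured with respect to the uniform distribution on $(X,Y)$.
   Context: Each of $k$ sites holds $1/\varepsilon^2$ blocks of $n$ bits; inputs communicate in the blackboard model (every message seen by all sites). $k$-XOR on one block: equals $1$ if there is a coordinate $j\in[n]$ in which exactly $k/2$ sites have a $1$, and $0$ otherwise. $k$-BTX: equals $1$ if $|\sum_{j}k\text{-XOR}(\text{block }j)-\frac{1}{2\varepsilon^2}|\ge2/\varepsilon$, equals $0$ if this quantity is $\le1/\varepsilon$, arbitrary otherwise. Distribution $\nu$: blocks independent, each drawn as follows: for each coordinate $\ell\in[n]$ choose $D^j_\ell$ uniformly from $[k]$; site $D^j_\ell$ gets a uniform bit, others $0$; then choose a special coordinate $M^j$ uniformly in $[n]$ and replace it: with probability $1/2$ all of the first $k/2$ sites get $0$ there, else all get $1$; independently the same for the last $k/2$ sites. $D=(D^j_\ell)$, $M=(M^1,\dots,M^{1/\varepsilon^2})$, $X^j=1$ iff the first $k/2$ sites all have $1$ in coordinate $M^j$ of block $j$, $Y^j$ likewise for the last $k/2$ sites; $X=(X^j)_j$, $Y=(Y^j)_j$.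
   Formalization: The formal statement takes k to be a power of 2 with k ≥ 4: for k = 1, k/2 is not an integer, and for k = 2 with n ≥ 2 the claim fails, since always answering 1 has vanishing error and reveals nothing; Ω is read as holding for all ε below an absolute constant. *)

theory Defs
  imports "HOL-Probability.Probability" "HOL-Library.Monad_Syntax"
begin

text \<open>
  Sites are \<open>0, \<dots>, k - 1\<close> (the first \<open>k/2\<close> of them being \<open>i < k div 2\<close>), blocks are
  \<open>0, \<dots>, N - 1\<close> with \<open>N = 1/\<epsilon>\<^sup>2\<close>, coordinates are \<open>0, \<dots>, n - 1\<close>.
  An input is indexed by site, block, coordinate.
\<close>

type_synonym site_input = "nat \<Rightarrow> nat \<Rightarrow> bool"
type_synonym inputs = "nat \<Rightarrow> site_input"

section \<open>The problems k-XOR and k-BTX\<close>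

definition kXOR :: "nat \<Rightarrow> nat \<Rightarrow> (nat \<Rightarrow> nat \<Rightarrow> bool) \<Rightarrow> bool" where
  "kXOR k n b \<longleftrightarrow> (\<exists>l<n. card {i. i < k \<and> b i l} = k div 2)"

text \<open>The value \<open>None\<close> means that every answer is admissible.\<close>

definition kBTX :: "real \<Rightarrow> nat \<Rightarrow> nat \<Rightarrow> nat \<Rightarrow> inputs \<Rightarrow> bool option" where
  "kBTX \<epsilon> k n N B =
     (let dev = \<bar>(\<Sum>j<N. of_bool (kXOR k n (\<lambda>i. B i j))) - 1 / (2 * \<epsilon>\<^sup>2)\<bar>
      in if dev \<ge> 2 / \<epsilon> then Some True
         else if dev \<le> 1 / \<epsilon> then Some False
         else None)"

section \<open>The input distribution\<close>

record block =
  Dir :: "nat \<Rightarrow> nat"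
  Special :: nat
  Bits :: "nat \<Rightarrow> nat \<Rightarrow> bool"

definition block_dist :: "nat \<Rightarrow> nat \<Rightarrow> block pmf" where
  "block_dist k n = do {
     d \<leftarrow> Pi_pmf {..<n} 0 (\<lambda>_. pmf_of_set {..<k});
     u \<leftarrow> Pi_pmf {..<n} False (\<lambda>_. bernoulli_pmf (1/2));
     m \<leftarrow> pmf_of_set {..<n};
     x \<leftarrow> bernoulli_pmf (1/2);
     y \<leftarrow> bernoulli_pmf (1/2);
     return_pmf \<lparr> Dir = d, Special = m,
       Bits = (\<lambda>i l. if l = m then (if i < k div 2 then x else y)
                     else i = d l \<and> u l) \<rparr> }"

definition nu :: "nat \<Rightarrow> nat \<Rightarrow> nat \<Rightarrow> (nat \<Rightarrow> block) pmf" where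
  "nu k n N = Pi_pmf {..<N} \<lparr> Dir = (\<lambda>_. 0), Special = 0, Bits = (\<lambda>_ _. False) \<rparr>
                (\<lambda>_. block_dist k n)"

definition inputs_of :: "(nat \<Rightarrow> block) \<Rightarrow> inputs" where
  "inputs_of w = (\<lambda>i j l. Bits (w j) i l)"

text \<open>
  The random variables below are encoded as lists so that they take values in countable types;
  on these, \<^term>\<open>count_space UNIV\<close> is sigma-finite, as the library's notions of information need.
\<close>

definition Dvar :: "nat \<Rightarrow> nat \<Rightarrow> (nat \<Rightarrow> block) \<Rightarrow> nat list list" where
  "Dvar n N w = map (\<lambda>j. map (Dir (w j)) [0..<n]) [0..<N]"

definition Mvar :: "nat \<Rightarrow> (nat \<Rightarrow> block) \<Rightarrow> nat list" where
  "Mvar N w = map (\<lambda>j. Special (w j)) [0..<N]"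

definition Xvar :: "nat \<Rightarrow> nat \<Rightarrow> (nat \<Rightarrow> block) \<Rightarrow> bool list" where
  "Xvar k N w = map (\<lambda>j. \<forall>i<k div 2. Bits (w j) i (Special (w j))) [0..<N]"

definition Yvar :: "nat \<Rightarrow> nat \<Rightarrow> (nat \<Rightarrow> block) \<Rightarrow> bool list" where
  "Yvar k N w = map (\<lambda>j. \<forall>i\<in>{k div 2..<k}. Bits (w j) i (Special (w j))) [0..<N]"

section \<open>Randomized blackboard protocols\<close>

text \<open>
  At a node \<open>Speak i f t\<^sub>0 t\<^sub>1\<close>, site \<open>i\<close> writes on the blackboard the bit that \<open>f\<close> computes
  from its own input and its own private coins. The node is determined by the bits written so
  far, so \<open>i\<close> and \<open>f\<close> may depend on everything on the blackboard.
\<close>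

datatype ptree =
    Output bool
  | Speak nat "site_input \<Rightarrow> nat \<Rightarrow> bool" ptree ptree

primrec speakers :: "ptree \<Rightarrow> nat set" where
  "speakers (Output v) = {}"
| "speakers (Speak i f t\<^sub>0 t\<^sub>1) = insert i (speakers t\<^sub>0 \<union> speakers t\<^sub>1)"

primrec board :: "ptree \<Rightarrow> inputs \<Rightarrow> (nat \<Rightarrow> nat) \<Rightarrow> bool list" where
  "board (Output v) B r = []"
| "board (Speak i f t\<^sub>0 t\<^sub>1) B r =
     (if f (B i) (r i) then True # board t\<^sub>1 B r else False # board t\<^sub>0 B r)"

primrec answer :: "ptree \<Rightarrow> inputs \<Rightarrow> (nat \<Rightarrow> nat) \<Rightarrow> bool" where
  "answer (Output v) B r = v"
| "answer (Speak i f t\<^sub>0 t\<^sub>1) B r =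
     (if f (B i) (r i) then answer t\<^sub>1 B r else answer t\<^sub>0 B r)"

text \<open>
  Public coins select the protocol tree; \<open>Private i\<close> is the distribution of the coins of site
  \<open>i\<close>. Coins of an arbitrary discrete distribution are encoded as natural numbers.
\<close>

record protocol =
  Public :: "nat pmf"
  Private :: "nat \<Rightarrow> nat pmf"
  Tree :: "nat \<Rightarrow> ptree"

definition blackboard_protocol :: "nat \<Rightarrow> protocol \<Rightarrow> bool" where
  "blackboard_protocol k P \<longleftrightarrow> (\<forall>s. speakers (Tree P s) \<subseteq> {..<k})"

type_synonym outcome = "(nat \<Rightarrow> block) \<times> nat \<times> (nat \<Rightarrow> nat)"

definition execution :: "nat \<Rightarrow> nat \<Rightarrow> nat \<Rightarrow> protocol \<Rightarrow> outcome pmf" where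
  "execution k n N P =
     pair_pmf (nu k n N) (pair_pmf (Public P) (Pi_pmf {..<k} 0 (Private P)))"

text \<open>
  The transcript contains the public coins. (If it did not, publicly shared one-time pads could
  make it independent of the input.)
\<close>

definition transcript :: "protocol \<Rightarrow> outcome \<Rightarrow> nat \<times> bool list" where
  "transcript P = (\<lambda>(w, s, r). (s, board (Tree P s) (inputs_of w) r))"

definition error_prob :: "real \<Rightarrow> nat \<Rightarrow> nat \<Rightarrow> nat \<Rightarrow> protocol \<Rightarrow> real" where
  "error_prob \<epsilon> k n N P =
     measure_pmf.prob (execution k n N P)
       {(w, s, r). kBTX \<epsilon> k n N (inputs_of w) = Some (\<not> answer (Tree P s) (inputs_of w) r)}"

section \<open>Information revealed by the transcript\<close>

text \<open>\<open>I(X, Y; \<Pi> | M, D)\<close>, in bits.\<close>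

definition transcript_information :: "nat \<Rightarrow> nat \<Rightarrow> nat \<Rightarrow> protocol \<Rightarrow> real" where
  "transcript_information k n N P =
     prob_space.conditional_mutual_information (measure_pmf (execution k n N P)) 2
       (count_space UNIV) (count_space UNIV) (count_space UNIV)
       (\<lambda>(w, s, r). (Xvar k N w, Yvar k N w))
       (transcript P)
       (\<lambda>(w, s, r). (Mvar N w, Dvar n N w))"

end

theory Submission
  imports Defs
begin

text \<open>
  Write \<open>X\<close> and \<open>Y\<close> as sign vectors. A block contributes to the \<open>k\<close>-BTX sum iff \<open>X\<^sup>j \<noteq> Y\<^sup>j\<close>, so a
  correct protocol decides whether \<open>\<bar>\<langle>X, Y\<rangle>\<bar>\<close> is at least \<open>4 \<surd>N\<close> or at most \<open>2 \<surd>N\<close>. Given \<open>M\<close>, \<open>D\<close> and the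
  public coins, the inputs of the two halves of the sites are independent, hence the probability of
  a transcript \<open>t\<close> factors as \<open>a t x * b t y\<close>.

  Compare the uniform law \<open>P\<close> of \<open>(X, Y)\<close> with the law \<open>Q\<close> under which the pairs \<open>(X\<^sup>j, Y\<^sup>j)\<close> are
  independent with correlation \<open>\<rho> = 8 / \<surd>N\<close>. The density of \<open>Q\<close> has bounded second moment, so a
  small error under \<open>P\<close> remains small under \<open>Q\<close>; by Chebyshev the answer is mostly ``no'' under \<open>P\<close> and
  mostly ``yes'' under \<open>Q\<close>. Therefore the laws of the transcript under \<open>Q\<close> and \<open>P\<close> have divergence
  bounded away from zero. On the other hand this divergence is at most \<open>8 \<rho>\<^sup>2\<close> times the information
  revealed under \<open>Q\<close>, which is at most a constant times the one revealed under \<open>P\<close>, plus a small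
  multiple of \<open>N\<close>. Since \<open>\<rho>\<^sup>2 = 64 / N\<close>, the information is of order \<open>N\<close>.

  The bound \<open>8 \<rho>\<^sup>2\<close> is obtained by revealing the coordinates one at a time: given \<open>t\<close> and
  \<open>(x\<^bsub><i\<^esub>, y\<^bsub>>i\<^esub>)\<close>, the pair \<open>(x\<^sub>i, y\<^sub>i)\<close> has under \<open>Q\<close> a law proportional to
  \<open>(1 + p x) (1 + q y) (1 + \<rho> x y)\<close>. The first-order contributions \<open>\<rho> p q\<close> cancel on average because
  \<open>x\<^sub>i y\<^sub>i\<close> has mean \<open>\<rho>\<close> under \<open>Q\<close>, and the remaining \<open>\<rho>\<^sup>2 (p\<^sup>2 + q\<^sup>2)\<close> is paid for by the
  information about \<open>x\<^sub>i\<close> and \<open>y\<^sub>i\<close>.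
\<close>

section \<open>Gibbs' inequality\<close>

lemma log_sum_inequality:
  fixes u v :: "'a \<Rightarrow> real"
  assumes "finite A" and u: "\<And>x. x \<in> A \<Longrightarrow> 0 \<le> u x" and v: "\<And>x. x \<in> A \<Longrightarrow> 0 \<le> v x"
    and abs_cont: "\<And>x. x \<in> A \<Longrightarrow> v x = 0 \<Longrightarrow> u x = 0"
  shows "sum u A * ln (sum u A / sum v A) \<le> (\<Sum>x\<in>A. u x * ln (u x / v x))"
proof (cases "sum u A = 0")
  case True
  then show ?thesis using \<open>finite A\<close> u by (simp add: sum_nonneg_eq_0_iff)
next
  case False
  then obtain x where "x \<in> A" "u x \<noteq> 0" by (meson sum.neutral)
  then have V: "sum v A > 0"
    using \<open>finite A\<close> v abs_cont by (intro sum_pos2[of A x]) (auto simp: less_le)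
  have U: "sum u A > 0" using False u by (simp add: less_le sum_nonneg)
  have "u x * (ln (sum u A / sum v A) - ln (u x / v x)) \<le> sum u A / sum v A * v x - u x"
    if "x \<in> A" for x
  proof (cases "u x = 0")
    case True
    then show ?thesis using U V v[OF that] by simp
  next
    case False
    then have pos: "u x > 0" "v x > 0" using u v abs_cont that by (auto simp: less_le)
    have "ln (sum u A / sum v A) - ln (u x / v x) = ln (sum u A / sum v A * v x / u x)"
      using U V pos by (simp add: ln_div ln_mult)
    also have "\<dots> \<le> sum u A / sum v A * v x / u x - 1"
      using U V pos by (intro ln_le_minus_one) simp
    finally have "u x * (ln (sum u A / sum v A) - ln (u x / v x)) \<le>
        u x * (sum u A / sum v A * v x / u x - 1)"
      using pos by (intro mult_left_mono) auto
    then show ?thesis using pos by (simp add: right_diff_distrib)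
  qed
  then have "(\<Sum>x\<in>A. u x * (ln (sum u A / sum v A) - ln (u x / v x))) \<le>
      (\<Sum>x\<in>A. sum u A / sum v A * v x - u x)"
    by (rule sum_mono)
  also have "\<dots> = 0" using V by (simp only: sum_subtractf flip: sum_distrib_left) simp
  finally show ?thesis
    by (simp add: right_diff_distrib sum_subtractf sum_distrib_right)
qed

lemma gibbs_inequality:
  fixes u v :: "'a \<Rightarrow> real"
  assumes "finite A" "\<And>x. x \<in> A \<Longrightarrow> 0 \<le> u x" "\<And>x. x \<in> A \<Longrightarrow> 0 \<le> v x"
    and "\<And>x. x \<in> A \<Longrightarrow> v x = 0 \<Longrightarrow> u x = 0" "sum u A = sum v A"
  shows "0 \<le> (\<Sum>x\<in>A. u x * ln (u x / v x))"
proof -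
  have "0 = sum u A * ln (sum u A / sum v A)"
    unfolding assms(5) by (cases "sum v A = 0") auto
  also have "\<dots> \<le> (\<Sum>x\<in>A. u x * ln (u x / v x))"
    using assms(1-4) by (rule log_sum_inequality)
  finally show ?thesis .
qed

section \<open>Means over sign vectors\<close>

definition spin :: "bool \<Rightarrow> real" where
  "spin b = (if b then 1 else -1)"

definition cube :: "nat \<Rightarrow> bool list set" where
  "cube N = {x. length x = N}"

definition tilt :: "real \<Rightarrow> bool list \<Rightarrow> bool list \<Rightarrow> real" where
  "tilt \<rho> x y = (\<Prod>(a, b)\<leftarrow>zip x y. 1 + \<rho> * spin a * spin b)"

definition corr :: "bool list \<Rightarrow> bool list \<Rightarrow> real" where
  "corr x y = (\<Sum>(a, b)\<leftarrow>zip x y. spin a * spin b)"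

definition bit_mean :: "(bool \<Rightarrow> real) \<Rightarrow> real" where
  "bit_mean f = (f True + f False) / 2"

definition cube_mean :: "nat \<Rightarrow> (bool list \<Rightarrow> real) \<Rightarrow> real" where
  "cube_mean N f = (\<Sum>x\<in>cube N. f x) / 2 ^ N"

definition tilt_mean :: "real \<Rightarrow> nat \<Rightarrow> (bool list \<Rightarrow> bool list \<Rightarrow> real) \<Rightarrow> real" where
  "tilt_mean \<rho> N f = cube_mean N (\<lambda>x. cube_mean N (\<lambda>y. tilt \<rho> x y * f x y))"

lemma spin_simps [simp]: "spin True = 1" "spin False = -1"
  by (simp_all add: spin_def)

lemma tilt_simps [simp]:
  "tilt \<rho> [] [] = 1" "tilt \<rho> (a # x) (b # y) = (1 + \<rho> * spin a * spin b) * tilt \<rho> x y"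
  by (simp_all add: tilt_def)

lemma corr_simps [simp]:
  "corr [] [] = 0" "corr (a # x) (b # y) = spin a * spin b + corr x y"
  by (simp_all add: corr_def)

lemma finite_cube [simp]: "finite (cube N)"
  using finite_lists_length_eq[of "UNIV :: bool set" N] by (simp add: cube_def)

lemma card_cube: "card (cube N) = 2 ^ N"
  using card_lists_length_eq[of "UNIV :: bool set" N] by (simp add: cube_def)

lemma cube_nonempty [simp]: "cube N \<noteq> {}"
  using card_cube[of N] by force

lemma cube_0 [simp]: "cube 0 = {[]}"
  by (auto simp: cube_def)

lemma cube_Suc: "cube (Suc N) = (#) True ` cube N \<union> (#) False ` cube N"
  by (auto simp: cube_def length_Suc_conv)

lemma one_plus_mult_pos:
  fixes \<rho> p :: real
  assumes "\<bar>\<rho>\<bar> < 1" "\<bar>p\<bar> \<le> 1"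
  shows "1 + \<rho> * p > 0"
proof -
  have "\<bar>\<rho> * p\<bar> \<le> \<bar>\<rho>\<bar> * 1" unfolding abs_mult using assms by (intro mult_left_mono) auto
  then show ?thesis using assms by (simp add: abs_le_iff)
qed

lemma one_plus_spin_pos: "\<bar>\<rho>\<bar> < 1 \<Longrightarrow> 1 + \<rho> * spin a * spin b > 0"
  using one_plus_mult_pos[of \<rho> "spin a * spin b"] by (cases a; cases b) auto

lemma tilt_pos:
  assumes "\<bar>\<rho>\<bar> < 1"
  shows "tilt \<rho> x y > 0"
proof (induction x y rule: list_induct2')
  case (4 a x b y)
  then show ?case using one_plus_spin_pos[OF assms] by simp
qed (simp_all add: tilt_def)

lemma tilt_0 [simp]: "tilt 0 x y = 1"
  by (induction x y rule: list_induct2') (simp_all add: tilt_def)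

lemma tilt_commute: "tilt \<rho> x y = tilt \<rho> y x"
  by (induction x y rule: list_induct2') (simp_all add: tilt_def mult_ac)

lemma bit_mean_add: "bit_mean (\<lambda>a. f a + g a) = bit_mean f + bit_mean g"
  by (simp add: bit_mean_def field_simps)

lemma cube_mean_0 [simp]: "cube_mean 0 f = f []"
  by (simp add: cube_mean_def)

lemma cube_mean_Suc: "cube_mean (Suc N) f = bit_mean (\<lambda>a. cube_mean N (\<lambda>x. f (a # x)))"
  unfolding cube_mean_def bit_mean_def cube_Suc
  by (subst sum.union_disjoint) (auto simp: sum.reindex field_simps)

lemma cube_mean_const [simp]: "cube_mean N (\<lambda>_. c) = c"
  by (simp add: cube_mean_def card_cube)

lemma cube_mean_add: "cube_mean N (\<lambda>x. f x + g x) = cube_mean N f + cube_mean N g"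
  by (simp add: cube_mean_def sum.distrib add_divide_distrib)

lemma cube_mean_cmult: "cube_mean N (\<lambda>x. c * f x) = c * cube_mean N f"
  by (simp add: cube_mean_def sum_distrib_left)

lemma cube_mean_swap:
  "cube_mean N (\<lambda>x. cube_mean M (f x)) = cube_mean M (\<lambda>y. cube_mean N (\<lambda>x. f x y))"
  by (simp add: cube_mean_def sum.swap[of _ "cube M"] mult.commute flip: sum_divide_distrib)

lemma cube_mean_bit_mean:
  "cube_mean N (\<lambda>x. bit_mean (f x)) = bit_mean (\<lambda>a. cube_mean N (\<lambda>x. f x a))"
  by (simp add: cube_mean_def bit_mean_def sum.distrib add_divide_distrib flip: sum_divide_distrib)

lemma cube_mean_mono: "(\<And>x. x \<in> cube N \<Longrightarrow> f x \<le> g x) \<Longrightarrow> cube_mean N f \<le> cube_mean N g"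
  by (simp add: cube_mean_def divide_right_mono sum_mono)

lemma cube_mean_cong: "(\<And>x. x \<in> cube N \<Longrightarrow> f x = g x) \<Longrightarrow> cube_mean N f = cube_mean N g"
  by (simp add: cube_mean_def)

lemma cube_mean_nonneg: "(\<And>x. x \<in> cube N \<Longrightarrow> 0 \<le> f x) \<Longrightarrow> 0 \<le> cube_mean N f"
  using cube_mean_mono[of N "\<lambda>_. 0" f] by simp

lemma cube_mean_pos:
  assumes "\<And>x. x \<in> cube N \<Longrightarrow> 0 \<le> f x" "x\<^sub>0 \<in> cube N" "0 < f x\<^sub>0"
  shows "0 < cube_mean N f"
  unfolding cube_mean_def using assms by (intro divide_pos_pos sum_pos2[of _ x\<^sub>0]) auto

lemma tilt_mean_0 [simp]: "tilt_mean \<rho> 0 f = f [] []"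
  by (simp add: tilt_mean_def)

lemma tilt_mean_Suc:
  "tilt_mean \<rho> (Suc N) f =
     bit_mean (\<lambda>a. bit_mean (\<lambda>b.
       (1 + \<rho> * spin a * spin b) * tilt_mean \<rho> N (\<lambda>x y. f (a # x) (b # y))))"
  by (simp add: tilt_mean_def cube_mean_Suc cube_mean_bit_mean mult.assoc flip: cube_mean_cmult)
    (simp add: bit_mean_def field_simps)

lemma tilt_mean_add: "tilt_mean \<rho> N (\<lambda>x y. f x y + g x y) = tilt_mean \<rho> N f + tilt_mean \<rho> N g"
  by (simp add: tilt_mean_def distrib_left cube_mean_add)

lemma tilt_mean_cmult: "tilt_mean \<rho> N (\<lambda>x y. c * f x y) = c * tilt_mean \<rho> N f"
  by (simp add: tilt_mean_def mult.left_commute[of _ c] cube_mean_cmult)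

lemma tilt_mean_diff: "tilt_mean \<rho> N (\<lambda>x y. f x y - g x y) = tilt_mean \<rho> N f - tilt_mean \<rho> N g"
  using tilt_mean_add[of \<rho> N f "\<lambda>x y. -1 * g x y"] tilt_mean_cmult[of \<rho> N "-1" g] by simp

lemma tilt_mean_bit_mean:
  "tilt_mean \<rho> N (\<lambda>x y. bit_mean (\<lambda>b. f b x y)) = bit_mean (\<lambda>b. tilt_mean \<rho> N (f b))"
  using tilt_mean_cmult[of \<rho> N "1 / 2"] by (simp add: bit_mean_def tilt_mean_add)

lemma tilt_mean_const [simp]: "tilt_mean \<rho> N (\<lambda>_ _. c) = c"
  by (induction N) (simp_all add: tilt_mean_Suc bit_mean_def field_simps)

lemma tilt_mean_sum: "tilt_mean \<rho> N (\<lambda>x y. \<Sum>t\<in>T. f t x y) = (\<Sum>t\<in>T. tilt_mean \<rho> N (f t))"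
  by (induction T rule: infinite_finite_induct) (simp_all add: tilt_mean_add)

lemma tilt_mean_cong:
  assumes "\<And>x y. x \<in> cube N \<Longrightarrow> y \<in> cube N \<Longrightarrow> f x y = g x y"
  shows "tilt_mean \<rho> N f = tilt_mean \<rho> N g"
  unfolding tilt_mean_def using assms by (intro cube_mean_cong) simp

lemma tilt_mean_mono:
  assumes "\<bar>\<rho>\<bar> < 1" "\<And>x y. x \<in> cube N \<Longrightarrow> y \<in> cube N \<Longrightarrow> f x y \<le> g x y"
  shows "tilt_mean \<rho> N f \<le> tilt_mean \<rho> N g"
  unfolding tilt_mean_def using assms tilt_pos[OF assms(1)]
  by (intro cube_mean_mono) (simp add: mult_left_mono less_imp_le)

lemma tilt_mean_nonneg:
  assumes "\<bar>\<rho>\<bar> < 1" "\<And>x y. x \<in> cube N \<Longrightarrow> y \<in> cube N \<Longrightarrow> 0 \<le> f x y"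
  shows "0 \<le> tilt_mean \<rho> N f"
  using tilt_mean_mono[OF assms(1), of N "\<lambda>_ _. 0" f] assms(2) by simp

lemma tilt_mean_corr: "tilt_mean \<rho> N (\<lambda>x y. corr x y - real N * \<rho>) = 0"
proof (induction N)
  case (Suc N)
  have "corr (a # x) (b # y) - real (Suc N) * \<rho> = (spin a * spin b - \<rho>) + (corr x y - real N * \<rho>)"
    for a b x y
    by (simp add: algebra_simps)
  then show ?case
    by (simp only: tilt_mean_Suc tilt_mean_add[of _ _ "\<lambda>_ _. _ - \<rho>"] Suc.IH tilt_mean_const)
      (simp add: bit_mean_def algebra_simps)
qed simp

lemma tilt_mean_corr_power2: "tilt_mean \<rho> N (\<lambda>x y. (corr x y - real N * \<rho>)\<^sup>2) = real N * (1 - \<rho>\<^sup>2)"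
proof (induction N)
  case (Suc N)
  have "(corr (a # x) (b # y) - real (Suc N) * \<rho>)\<^sup>2 = (spin a * spin b - \<rho>)\<^sup>2
      + (2 * (spin a * spin b - \<rho>) * (corr x y - real N * \<rho>) + (corr x y - real N * \<rho>)\<^sup>2)"
    for a b x y
    by (simp add: algebra_simps power2_eq_square)
  then have step: "tilt_mean \<rho> N (\<lambda>x y. (corr (a # x) (b # y) - real (Suc N) * \<rho>)\<^sup>2) =
      (spin a * spin b - \<rho>)\<^sup>2 + real N * (1 - \<rho>\<^sup>2)" for a b
    by (simp only: tilt_mean_add tilt_mean_cmult tilt_mean_corr tilt_mean_const Suc.IH)
  show ?case
    by (simp only: tilt_mean_Suc step) (simp add: bit_mean_def power2_eq_square field_simps)
qed simp

lemma tilt_mean_tilt: "tilt_mean \<rho> N (tilt \<rho>) = (1 + \<rho>\<^sup>2) ^ N"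
proof (induction N)
  case (Suc N)
  then show ?case
    by (simp only: tilt_mean_Suc tilt_simps tilt_mean_cmult)
      (simp add: bit_mean_def power2_eq_square algebra_simps)
qed simp

lemma tilt_mean_corr_deviation_le:
  assumes "\<bar>\<rho>\<bar> < 1" "c > 0"
  shows "tilt_mean \<rho> N (\<lambda>x y. of_bool (c \<le> \<bar>corr x y - real N * \<rho>\<bar>)) \<le> real N / c\<^sup>2"
proof -
  have "tilt_mean \<rho> N (\<lambda>x y. of_bool (c \<le> \<bar>corr x y - real N * \<rho>\<bar>))
      \<le> tilt_mean \<rho> N (\<lambda>x y. 1 / c\<^sup>2 * (corr x y - real N * \<rho>)\<^sup>2)"
  proof (rule tilt_mean_mono[OF assms(1)])
    fix x y
    have "c\<^sup>2 \<le> (corr x y - real N * \<rho>)\<^sup>2" if "c \<le> \<bar>corr x y - real N * \<rho>\<bar>"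
      using power_mono[OF that, of 2] assms(2) by simp
    then show "of_bool (c \<le> \<bar>corr x y - real N * \<rho>\<bar>) \<le> 1 / c\<^sup>2 * (corr x y - real N * \<rho>)\<^sup>2"
      using assms(2) by (simp add: of_bool_def field_simps)
  qed
  also have "\<dots> = real N * (1 - \<rho>\<^sup>2) / c\<^sup>2"
    by (simp only: tilt_mean_cmult tilt_mean_corr_power2) simp
  also have "\<dots> \<le> real N / c\<^sup>2"
    by (intro divide_right_mono mult_left_le) auto
  finally show ?thesis .
qed

lemma le_add_power2_div:
  fixes L K :: real
  assumes "K > 0"
  shows "L \<le> K + L\<^sup>2 / K"
proof -
  have "L * K \<le> K\<^sup>2 + L\<^sup>2"
    using sum_squares_bound[of L K] zero_le_power2[of L] zero_le_power2[of K] by linarith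
  then show ?thesis using assms by (simp add: field_simps power2_eq_square)
qed

lemma tilt_mean_le_uniform_mean:
  assumes \<rho>: "\<bar>\<rho>\<bar> < 1" and K: "K > 0"
    and f: "\<And>x y. x \<in> cube N \<Longrightarrow> y \<in> cube N \<Longrightarrow> 0 \<le> f x y \<and> f x y \<le> B"
  shows "tilt_mean \<rho> N f \<le> K * tilt_mean 0 N f + B * exp (real N * \<rho>\<^sup>2) / K"
proof -
  have B: "B \<ge> 0"
    using f[of "replicate N True" "replicate N True"] by (auto simp: cube_def)
  have "tilt_mean \<rho> N f = tilt_mean 0 N (\<lambda>x y. tilt \<rho> x y * f x y)"
    by (simp add: tilt_mean_def)
  also have "\<dots> \<le> tilt_mean 0 N (\<lambda>x y. K * f x y + B / K * (tilt \<rho> x y)\<^sup>2)"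
  proof (rule tilt_mean_mono)
    fix x y assume "x \<in> cube N" "y \<in> cube N"
    note f = f[OF this]
    have "tilt \<rho> x y * f x y \<le> (K + (tilt \<rho> x y)\<^sup>2 / K) * f x y"
      using f by (intro mult_right_mono le_add_power2_div K) auto
    also have "\<dots> = K * f x y + (tilt \<rho> x y)\<^sup>2 / K * f x y" by (simp add: distrib_right)
    also have "(tilt \<rho> x y)\<^sup>2 / K * f x y \<le> (tilt \<rho> x y)\<^sup>2 / K * B"
      using f K by (intro mult_left_mono) auto
    finally show "tilt \<rho> x y * f x y \<le> K * f x y + B / K * (tilt \<rho> x y)\<^sup>2"
      by (simp add: mult_ac)
  qed simp
  also have "\<dots> = K * tilt_mean 0 N f + B / K * tilt_mean \<rho> N (tilt \<rho>)"
    by (simp only: tilt_mean_add tilt_mean_cmult) (simp add: tilt_mean_def power2_eq_square)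
  also have "tilt_mean \<rho> N (tilt \<rho>) \<le> exp (real N * \<rho>\<^sup>2)"
    unfolding tilt_mean_tilt exp_of_nat_mult by (intro power_mono exp_ge_add_one_self) simp
  finally show ?thesis using B K by (simp add: mult_left_mono divide_right_mono)
qed

section \<open>Biased bits\<close>

definition bias :: "(bool \<Rightarrow> real) \<Rightarrow> real" where
  "bias g = (g True - g False) / (g True + g False)"

lemma eq_bit_mean_bias:
  assumes "\<And>a. 0 \<le> g a"
  shows "g a = bit_mean g * (1 + bias g * spin a)"
proof (cases "g True + g False = 0")
  case True
  then have "g True = 0" "g False = 0" using assms[of True] assms[of False] by linarith+
  then show ?thesis by (cases a) (auto simp: bit_mean_def)
next
  case False
  then show ?thesis
    unfolding bias_def bit_mean_def by (cases a) (auto simp: field_simps)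
qed

lemma abs_bias_le_1:
  assumes "\<And>a. 0 \<le> g a"
  shows "\<bar>bias g\<bar> \<le> 1"
  using assms[of True] assms[of False]
  by (cases "g True + g False = 0")
    (auto simp: bias_def abs_le_iff divide_le_eq_1 divide_le_eq field_simps)

lemma bit_mean_nonneg: "(\<And>a. 0 \<le> g a) \<Longrightarrow> 0 \<le> bit_mean g"
  by (simp add: bit_mean_def)

lemma bit_mean_pos: "(\<And>a. 0 \<le> g a) \<Longrightarrow> 0 < g a \<Longrightarrow> 0 < bit_mean g"
  unfolding bit_mean_def by (cases a) (auto intro: add_pos_nonneg add_nonneg_pos)

lemma one_plus_bias_pos:
  assumes "\<And>a. 0 \<le> g a" "0 < g a"
  shows "0 < 1 + bias g * spin a"
  using eq_bit_mean_bias[of g a, OF assms(1)] bit_mean_pos[of g a, OF assms] assms(2)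
  by (metis zero_less_mult_pos)

lemma bit_mean_correlated:
  assumes "\<And>b. 0 \<le> g b"
  shows "bit_mean (\<lambda>b. (1 + \<rho> * spin a * spin b) * g b) = bit_mean g * (1 + \<rho> * bias g * spin a)"
proof -
  define m \<beta> where "m = bit_mean g" and "\<beta> = bias g"
  have g: "g True = m * (1 + \<beta>)" "g False = m * (1 - \<beta>)"
    unfolding m_def \<beta>_def using eq_bit_mean_bias[of g, OF assms] by simp_all
  show ?thesis
    unfolding m_def[symmetric] \<beta>_def[symmetric] unfolding bit_mean_def by (simp add: g field_simps)
qed

lemma one_plus_tilted_bias_pos:
  assumes "\<bar>\<rho>\<bar> < 1" "\<And>b. 0 \<le> g b"
  shows "0 < 1 + \<rho> * bias g * spin a"
  using one_plus_mult_pos[OF assms(1), of "bias g * spin a"] abs_bias_le_1[of g, OF assms(2)]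
  by (simp add: abs_mult spin_def mult.assoc)

lemma ln_eq_ln_bit_mean_bias:
  assumes "\<And>a. 0 \<le> g a" "0 < g a"
  shows "ln (g a) = ln (bit_mean g) + ln (1 + bias g * spin a)"
  using eq_bit_mean_bias[of g a, OF assms(1)] bit_mean_pos[of g a, OF assms]
    one_plus_bias_pos[of g a, OF assms]
  by (metis ln_mult_pos)

lemma ln_bit_mean_correlated:
  assumes "\<bar>\<rho>\<bar> < 1" "\<And>b. 0 \<le> g b" "0 < g b"
  shows "ln (bit_mean (\<lambda>b. (1 + \<rho> * spin a * spin b) * g b)) =
    ln (bit_mean g) + ln (1 + \<rho> * bias g * spin a)"
  unfolding bit_mean_correlated[of g, OF assms(2)]
  using bit_mean_pos[of g b, OF assms(2,3)] one_plus_tilted_bias_pos[of \<rho> g a, OF assms(1,2)]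
  by (intro ln_mult_pos)

text \<open>
  The integral of \<open>\<phi>\<close> against the (not normalized) law of two signs of biases \<open>p\<close> and \<open>q\<close>
  tilted towards correlation \<open>\<rho>\<close>.
\<close>

definition sign_mean :: "real \<Rightarrow> real \<Rightarrow> real \<Rightarrow> (real \<Rightarrow> real \<Rightarrow> real) \<Rightarrow> real" where
  "sign_mean \<rho> p q \<phi> =
     (\<Sum>x\<in>{1, -1}. \<Sum>y\<in>{1, -1}. (1 + p * x) * (1 + q * y) * (1 + \<rho> * x * y) * \<phi> x y) / 4"

lemma bit_mean_eq_sign_mean:
  assumes "\<And>a. 0 \<le> g a" "\<And>b. 0 \<le> h b"
  shows "bit_mean (\<lambda>a. bit_mean (\<lambda>b.
      (1 + \<rho> * spin a * spin b) * (g a * h b * \<phi> (spin a) (spin b)))) =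
    bit_mean g * bit_mean h * sign_mean \<rho> (bias g) (bias h) \<phi>"
proof -
  define m \<beta> m' \<beta>' where "m = bit_mean g" and "\<beta> = bias g" and "m' = bit_mean h" and "\<beta>' = bias h"
  have g: "g a = m * (1 + \<beta> * spin a)" and h: "h a = m' * (1 + \<beta>' * spin a)" for a
    unfolding m_def \<beta>_def m'_def \<beta>'_def
    using eq_bit_mean_bias[of g, OF assms(1)] eq_bit_mean_bias[of h, OF assms(2)] by auto
  show ?thesis
    unfolding m_def[symmetric] \<beta>_def[symmetric] m'_def[symmetric] \<beta>'_def[symmetric]
    unfolding bit_mean_def sign_mean_def g h by (simp add: field_simps)
qed

lemma sign_mean_add:
  "sign_mean \<rho> p q (\<lambda>x y. \<phi> x y + \<psi> x y) = sign_mean \<rho> p q \<phi> + sign_mean \<rho> p q \<psi>"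
  by (simp add: sign_mean_def field_simps)

lemma sign_mean_diff:
  "sign_mean \<rho> p q (\<lambda>x y. \<phi> x y - \<psi> x y) = sign_mean \<rho> p q \<phi> - sign_mean \<rho> p q \<psi>"
  by (simp add: sign_mean_def field_simps)

lemma sign_mean_cmult: "sign_mean \<rho> p q (\<lambda>x y. c * \<phi> x y) = c * sign_mean \<rho> p q \<phi>"
  by (simp add: sign_mean_def field_simps)

lemma sign_mean_commute: "sign_mean \<rho> q p (\<lambda>x y. \<phi> y x) = sign_mean \<rho> p q \<phi>"
  by (simp add: sign_mean_def field_simps)

lemma sign_mean_fst:
  "sign_mean \<rho> p q (\<lambda>x y. \<phi> x) = (\<Sum>x\<in>{1, -1}. (1 + p * x) * (1 + \<rho> * q * x) * \<phi> x) / 2"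
  by (simp add: sign_mean_def field_simps)

lemma sign_mean_const: "sign_mean \<rho> p q (\<lambda>_ _. c) = (1 + \<rho> * p * q) * c"
  by (simp add: sign_mean_def field_simps)

lemma sign_mean_mono:
  assumes "\<bar>\<rho>\<bar> < 1" "\<bar>p\<bar> \<le> 1" "\<bar>q\<bar> \<le> 1" "\<And>x y. \<bar>x\<bar> = 1 \<Longrightarrow> \<bar>y\<bar> = 1 \<Longrightarrow> \<phi> x y \<le> \<psi> x y"
  shows "sign_mean \<rho> p q \<phi> \<le> sign_mean \<rho> p q \<psi>"
  unfolding sign_mean_def using assms
  by (intro divide_right_mono sum_mono mult_left_mono mult_nonneg_nonneg) (auto simp: abs_le_iff)

section \<open>The inequality for one coordinate\<close>

lemma mult_ln_ge:
  fixes t :: real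
  assumes "-1 \<le> t"
  shows "t \<le> (1 + t) * ln (1 + t)"
proof (cases "t = -1")
  case False
  then have "1 + t > 0" using assms by simp
  moreover from this have "1 - inverse (1 + t) \<le> ln (1 + t)"
    using ln_le_minus_one[of "inverse (1 + t)"] by (simp add: ln_inverse)
  ultimately have "(1 + t) * (1 - inverse (1 + t)) \<le> (1 + t) * ln (1 + t)"
    by (intro mult_left_mono) auto
  then show ?thesis using \<open>1 + t > 0\<close> by (simp add: right_diff_distrib)
qed simp

lemma mult_ln_le:
  fixes t :: real
  assumes "-1 \<le> t"
  shows "(1 + t) * ln (1 + t) \<le> t + t\<^sup>2"
proof (cases "t = -1")
  case False
  then have "(1 + t) * ln (1 + t) \<le> (1 + t) * t"
    using assms ln_le_minus_one[of "1 + t"] by (intro mult_left_mono) auto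
  then show ?thesis by (simp add: power2_eq_square algebra_simps)
qed simp

text \<open>The bound on the logarithm of \<open>r = sqrt (1 + t)\<close> gives \<open>(1 + t) ln (1 + t) \<ge> t + (r - 1)\<^sup>2\<close>.\<close>

lemma mult_ln_ge_quadratic:
  fixes t :: real
  assumes "\<bar>t\<bar> \<le> 1"
  shows "t + t\<^sup>2 / 6 \<le> (1 + t) * ln (1 + t)"
proof -
  define r where "r = sqrt (1 + t)"
  have r: "0 \<le> r" "r\<^sup>2 = 1 + t" using assms by (auto simp: r_def)
  have "r \<le> 1.42"
    unfolding r_def using assms by (intro real_le_lsqrt) (auto simp: power2_eq_square)
  then have "(r + 1)\<^sup>2 \<le> (1.42 + 1)\<^sup>2" using r by (intro power_mono) auto
  also have "\<dots> \<le> (6::real)" by (simp add: power2_eq_square)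
  finally have "(r - 1)\<^sup>2 * (r + 1)\<^sup>2 \<le> (r - 1)\<^sup>2 * 6" by (intro mult_left_mono) auto
  also have "(r - 1)\<^sup>2 * (r + 1)\<^sup>2 = t\<^sup>2"
    using r(2) by (simp flip: power_mult_distrib) (simp add: power2_eq_square algebra_simps)
  finally have "t + t\<^sup>2 / 6 \<le> t + (r - 1)\<^sup>2" by simp
  also have "\<dots> = 2 * (r * (r - 1))"
    using r(2) by (simp add: power2_eq_square algebra_simps)
  also have "\<dots> \<le> 2 * (r * (r * ln r))"
    using mult_ln_ge[of "r - 1"] r(1) by (intro mult_left_mono) auto
  also have "\<dots> = (1 + t) * ln (1 + t)"
    using r(1) by (cases "r = 0") (simp_all add: ln_realpow flip: r(2), simp add: power2_eq_square)
  finally show ?thesis .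
qed

lemma sign_mean_ln_fst_ge:
  assumes "0 \<le> \<rho>" and p: "\<bar>p\<bar> \<le> 1"
  shows "p\<^sup>2 / 6 - 3 / 2 * \<rho> * \<bar>p * q\<bar> \<le> sign_mean \<rho> p q (\<lambda>x y. ln (1 + p * x))"
proof -
  define L where "L s = (1 + s * p) * ln (1 + s * p)" for s
  have even: "L 1 + L (-1) \<ge> p\<^sup>2 / 3"
    using mult_ln_ge_quadratic[of p] mult_ln_ge_quadratic[of "-p"] p by (simp add: L_def)
  have "p\<^sup>2 \<le> \<bar>p\<bar>"
    using mult_left_le[of "\<bar>p\<bar>" "\<bar>p\<bar>"] p by (simp add: power2_eq_square flip: abs_mult)
  then have "\<bar>L 1 - L (-1)\<bar> \<le> 3 * \<bar>p\<bar>"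
    using mult_ln_ge[of p] mult_ln_ge[of "-p"] mult_ln_le[of p] mult_ln_le[of "-p"] p
    by (simp add: L_def abs_le_iff) linarith
  then have "\<bar>\<rho> * q * (L 1 - L (-1))\<bar> \<le> \<bar>\<rho> * q\<bar> * (3 * \<bar>p\<bar>)"
    unfolding abs_mult[of "\<rho> * q"] by (rule mult_left_mono) simp
  also have "\<dots> = 3 * \<rho> * \<bar>p * q\<bar>" using assms(1) by (simp add: abs_mult)
  finally have odd: "- (3 * \<rho> * \<bar>p * q\<bar>) \<le> \<rho> * q * (L 1 - L (-1))"
    by (simp add: abs_le_iff)
  have "sign_mean \<rho> p q (\<lambda>x y. ln (1 + p * x)) = (L 1 + L (-1) + \<rho> * q * (L 1 - L (-1))) / 2"
    by (simp add: sign_mean_fst L_def algebra_simps)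
  then show ?thesis using even odd by simp
qed

lemma sign_mean_ln_snd_ge:
  assumes "0 \<le> \<rho>" "\<bar>q\<bar> \<le> 1"
  shows "q\<^sup>2 / 6 - 3 / 2 * \<rho> * \<bar>p * q\<bar> \<le> sign_mean \<rho> p q (\<lambda>x y. ln (1 + q * y))"
  using sign_mean_ln_fst_ge[OF assms, of p] sign_mean_commute[of \<rho> q p "\<lambda>x y. ln (1 + q * y)"]
  by (simp add: mult.commute[of p q])

lemma sign_mean_ln_tilt_fst_le:
  assumes "\<bar>\<rho>\<bar> < 1" "\<bar>p\<bar> \<le> 1" "\<bar>q\<bar> \<le> 1"
  shows "sign_mean \<rho> p q (\<lambda>x y. ln (1 + \<rho> * q * x)) \<le> \<rho> * p * q + \<rho>\<^sup>2 * q\<^sup>2"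
proof -
  have "ln (1 + \<rho> * q * x) \<le> \<rho> * q * x" if "\<bar>x\<bar> = 1" for x
    using one_plus_mult_pos[of \<rho> "q * x"] ln_le_minus_one[of "1 + \<rho> * q * x"] assms that
    by (simp add: abs_mult mult.assoc)
  then have "sign_mean \<rho> p q (\<lambda>x y. ln (1 + \<rho> * q * x)) \<le> sign_mean \<rho> p q (\<lambda>x y. \<rho> * q * x)"
    using assms by (intro sign_mean_mono) auto
  also have "\<dots> = \<rho> * p * q + \<rho>\<^sup>2 * q\<^sup>2"
    by (simp add: sign_mean_fst power2_eq_square field_simps)
  finally show ?thesis .
qed

lemma sign_mean_ln_tilt_snd_le:
  assumes "\<bar>\<rho>\<bar> < 1" "\<bar>p\<bar> \<le> 1" "\<bar>q\<bar> \<le> 1"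
  shows "sign_mean \<rho> p q (\<lambda>x y. ln (1 + \<rho> * p * y)) \<le> \<rho> * p * q + \<rho>\<^sup>2 * p\<^sup>2"
  using sign_mean_ln_tilt_fst_le[of \<rho> q p, OF assms(1,3,2)]
    sign_mean_commute[of \<rho> q p "\<lambda>x y. ln (1 + \<rho> * p * y)"]
  by (simp add: mult_ac)

text \<open>Gibbs' inequality for the first sign, whose law is proportional to \<open>(1 + p x) (1 + \<rho> q x)\<close>.\<close>

lemma sign_mean_ln_fst_le:
  assumes \<rho>: "\<bar>\<rho>\<bar> < 1" and p: "\<bar>p\<bar> \<le> 1" and q: "\<bar>q\<bar> \<le> 1" and \<gamma>: "\<bar>\<gamma>\<bar> \<le> 1"
    and abs_cont: "\<And>x. \<bar>x\<bar> = 1 \<Longrightarrow> 1 + \<gamma> * x = 0 \<Longrightarrow> 1 + p * x = 0"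
  shows "sign_mean \<rho> p q (\<lambda>x y. ln (1 + \<gamma> * x)) \<le>
    sign_mean \<rho> p q (\<lambda>x y. ln (1 + p * x) + ln (1 + \<rho> * q * x) - ln (1 + \<rho> * p * q))"
proof -
  define u where "u x = (1 + p * x) * (1 + \<rho> * q * x)" for x
  define v where "v x = (1 + \<rho> * p * q) * (1 + \<gamma> * x)" for x
  have c: "1 + \<rho> * p * q > 0"
    using one_plus_mult_pos[OF \<rho>, of "p * q"] p q by (simp add: abs_mult mult_le_one mult.assoc)
  have factors_nonneg: "1 + \<rho> * q * x > 0" "1 + p * x \<ge> 0" "1 + \<gamma> * x \<ge> 0" if "x \<in> {1, -1}" for x
    using one_plus_mult_pos[OF \<rho>, of "q * x"] p q \<gamma> that by (auto simp: abs_le_iff mult.assoc)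
  have sums_eq: "sum u {1, -1} = sum v {1, -1}" by (simp add: u_def v_def algebra_simps)
  have "0 \<le> (\<Sum>x\<in>{1, -1}. u x * ln (u x / v x))"
    using factors_nonneg c abs_cont[of 1] abs_cont[of "-1"]
    by (intro gibbs_inequality sums_eq) (auto simp: u_def v_def less_imp_le)
  also have "\<dots> = (\<Sum>x\<in>{1, -1}. u x * (ln (1 + p * x) + ln (1 + \<rho> * q * x) - ln (1 + \<rho> * p * q)))
      - (\<Sum>x\<in>{1, -1}. u x * ln (1 + \<gamma> * x))"
    unfolding sum_subtractf[symmetric]
  proof (intro sum.cong refl)
    fix x :: real assume x: "x \<in> {1, -1}"
    show "u x * ln (u x / v x) = u x * (ln (1 + p * x) + ln (1 + \<rho> * q * x) - ln (1 + \<rho> * p * q))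
      - u x * ln (1 + \<gamma> * x)"
    proof (cases "1 + p * x = 0")
      case False
      then have "1 + p * x > 0" "1 + \<gamma> * x > 0"
        using abs_cont[of x] factors_nonneg[OF x] x by (auto simp: less_le)
      then have "ln (u x / v x) =
          (ln (1 + p * x) + ln (1 + \<rho> * q * x) - ln (1 + \<rho> * p * q)) - ln (1 + \<gamma> * x)"
        using factors_nonneg(1)[OF x] c by (simp add: u_def v_def ln_div ln_mult)
      then show ?thesis by (simp only: right_diff_distrib)
    qed (simp add: u_def)
  qed
  finally show ?thesis unfolding sign_mean_fst u_def by simp
qed

text \<open>
  The contribution of a coordinate \<open>(x, y)\<close> to the \<open>surplus\<close> defined below: \<open>p\<close>, \<open>q\<close> and \<open>\<gamma>\<close> are
  the biases of its law, conditionally on the coordinates already revealed.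
\<close>

definition sign_surplus :: "real \<Rightarrow> real \<Rightarrow> real \<Rightarrow> real \<Rightarrow> real \<Rightarrow> real \<Rightarrow> real" where
  "sign_surplus \<rho> p q \<gamma> x y =
     8 * \<rho>\<^sup>2 * ((ln (1 + p * x) - ln (1 + \<rho> * p * y)) + (ln (1 + q * y) - ln (1 + \<rho> * q * x)))
     + \<rho> / (1 - \<rho>\<^sup>2) * (x * y - \<rho>)
     - (ln (1 + \<rho> * p * y) - ln (1 + p * x) + ln (1 + \<gamma> * x))"

lemma sign_mean_information_ge:
  assumes \<rho>: "0 \<le> \<rho>" "\<rho> \<le> 1 / 100" and p: "\<bar>p\<bar> \<le> 1" and q: "\<bar>q\<bar> \<le> 1"
  shows "(p\<^sup>2 + q\<^sup>2) / 8 \<le> sign_mean \<rho> p q (\<lambda>x y.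
     (ln (1 + p * x) - ln (1 + \<rho> * p * y)) + (ln (1 + q * y) - ln (1 + \<rho> * q * x)))"
proof -
  have \<rho>1: "\<bar>\<rho>\<bar> < 1" using \<rho> by simp
  have "2 * \<bar>p * q\<bar> \<le> p\<^sup>2 + q\<^sup>2"
    using sum_squares_bound[of "\<bar>p\<bar>" "\<bar>q\<bar>"] by (simp add: abs_mult)
  then have pq: "\<rho> * \<bar>p * q\<bar> \<le> (p\<^sup>2 + q\<^sup>2) / 200"
    using mult_mono[OF \<rho>(2), of "2 * \<bar>p * q\<bar>" "p\<^sup>2 + q\<^sup>2"] \<rho> by simp
  have "\<rho>\<^sup>2 * (p\<^sup>2 + q\<^sup>2) \<le> (1 / 100)\<^sup>2 * (p\<^sup>2 + q\<^sup>2)"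
    using \<rho> by (intro mult_right_mono power_mono) auto
  then have \<rho>2: "\<rho>\<^sup>2 * (p\<^sup>2 + q\<^sup>2) \<le> (p\<^sup>2 + q\<^sup>2) / 10000"
    by (simp add: power2_eq_square[of "1 / 100"])
  have "\<rho> * p * q \<le> \<rho> * \<bar>p * q\<bar>" using \<rho> by (simp add: mult.assoc mult_left_mono)
  then have upper:
    "sign_mean \<rho> p q (\<lambda>x y. ln (1 + \<rho> * p * y)) + sign_mean \<rho> p q (\<lambda>x y. ln (1 + \<rho> * q * x))
      \<le> 2 * (\<rho> * \<bar>p * q\<bar>) + \<rho>\<^sup>2 * (p\<^sup>2 + q\<^sup>2)"
    using sign_mean_ln_tilt_fst_le[OF \<rho>1 p q] sign_mean_ln_tilt_snd_le[OF \<rho>1 p q]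
    by (simp add: distrib_left)
  have lower: "(p\<^sup>2 + q\<^sup>2) / 6 - 3 * (\<rho> * \<bar>p * q\<bar>)
      \<le> sign_mean \<rho> p q (\<lambda>x y. ln (1 + p * x)) + sign_mean \<rho> p q (\<lambda>x y. ln (1 + q * y))"
    using sign_mean_ln_fst_ge[OF \<rho>(1) p, of q] sign_mean_ln_snd_ge[OF \<rho>(1) q, of p]
    by (simp add: field_simps)
  have "s / 8 \<le> (m - l) + (m' - l')"
    if "a \<le> s / 200" "b \<le> s / 10000" "l + l' \<le> 2 * a + b" "s / 6 - 3 * a \<le> m + m'" "0 \<le> s"
    for a b s l l' m m' :: real
    using that by linarith
  from this[OF pq \<rho>2 upper lower] show ?thesis
    unfolding sign_mean_add sign_mean_diff by simp
qed

lemma sign_mean_sign_surplus_nonneg: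
  assumes \<rho>: "0 \<le> \<rho>" "\<rho> \<le> 1 / 100" and p: "\<bar>p\<bar> \<le> 1" and q: "\<bar>q\<bar> \<le> 1" and \<gamma>: "\<bar>\<gamma>\<bar> \<le> 1"
    and abs_cont: "\<And>x. \<bar>x\<bar> = 1 \<Longrightarrow> 1 + \<gamma> * x = 0 \<Longrightarrow> 1 + p * x = 0"
  shows "0 \<le> sign_mean \<rho> p q (sign_surplus \<rho> p q \<gamma>)"
proof -
  have \<rho>1: "\<bar>\<rho>\<bar> < 1" using \<rho> by simp
  have "\<bar>p * q\<bar> \<le> 1" using p q by (simp add: abs_mult mult_le_one)
  then have "\<rho> * p * q \<le> (1 + \<rho> * p * q) * ln (1 + \<rho> * p * q)"
    using one_plus_mult_pos[OF \<rho>1, of "p * q"] by (intro mult_ln_ge) (simp add: mult.assoc)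
  then have "sign_mean \<rho> p q (\<lambda>x y. ln (1 + \<rho> * p * y) - ln (1 + p * x) + ln (1 + \<gamma> * x))
      \<le> \<rho> * p * q + \<rho>\<^sup>2 * (p\<^sup>2 + q\<^sup>2)"
    using sign_mean_ln_fst_le[OF \<rho>1 p q \<gamma> abs_cont]
      sign_mean_ln_tilt_fst_le[OF \<rho>1 p q] sign_mean_ln_tilt_snd_le[OF \<rho>1 p q]
    by (simp add: sign_mean_add sign_mean_diff sign_mean_const distrib_left)
  also have "\<rho> * p * q = sign_mean \<rho> p q (\<lambda>x y. \<rho> / (1 - \<rho>\<^sup>2) * (x * y - \<rho>))"
  proof -
    have "1 - \<rho>\<^sup>2 \<noteq> 0" using \<rho>1 abs_square_less_1[of \<rho>] by simp
    moreover have "sign_mean \<rho> p q (\<lambda>x y. x * y - \<rho>) = p * q * (1 - \<rho>\<^sup>2)"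
      by (simp add: sign_mean_def power2_eq_square field_simps)
    ultimately show ?thesis by (simp only: sign_mean_cmult) simp
  qed
  also have "\<rho>\<^sup>2 * (p\<^sup>2 + q\<^sup>2) \<le> sign_mean \<rho> p q (\<lambda>x y. 8 * \<rho>\<^sup>2 *
      ((ln (1 + p * x) - ln (1 + \<rho> * p * y)) + (ln (1 + q * y) - ln (1 + \<rho> * q * x))))"
    unfolding sign_mean_cmult
    using mult_left_mono[OF sign_mean_information_ge[OF \<rho> p q], of "8 * \<rho>\<^sup>2"] by simp
  finally show ?thesis
    unfolding sign_surplus_def sign_mean_diff sign_mean_add[of _ _ _ _ "\<lambda>x y. _ * (x * y - _)"]
    by simp
qed

section \<open>The inequality for a rectangle\<close>

definition noise :: "real \<Rightarrow> nat \<Rightarrow> (bool list \<Rightarrow> real) \<Rightarrow> bool list \<Rightarrow> real" where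
  "noise \<rho> N \<alpha> y = cube_mean N (\<lambda>x. tilt \<rho> x y * \<alpha> x)"

lemma tilt_mean_mult_right:
  "tilt_mean \<rho> N (\<lambda>x y. \<alpha> x * \<psi> y) = cube_mean N (\<lambda>y. noise \<rho> N \<alpha> y * \<psi> y)"
  unfolding tilt_mean_def noise_def
  by (subst cube_mean_swap) (simp add: mult_ac flip: cube_mean_cmult)

lemma tilt_mean_commute: "tilt_mean \<rho> N (\<lambda>x y. f y x) = tilt_mean \<rho> N f"
  unfolding tilt_mean_def by (subst cube_mean_swap) (simp add: tilt_commute)

lemma noise_nonneg:
  assumes "\<bar>\<rho>\<bar> < 1" "\<And>x. 0 \<le> \<alpha> x"
  shows "0 \<le> noise \<rho> N \<alpha> y"
  unfolding noise_def using assms(2) tilt_pos[OF assms(1)]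
  by (intro cube_mean_nonneg mult_nonneg_nonneg) (auto intro: less_imp_le)

lemma noise_pos:
  assumes "\<bar>\<rho>\<bar> < 1" "\<And>x. 0 \<le> \<alpha> x" "x \<in> cube N" "0 < \<alpha> x"
  shows "0 < noise \<rho> N \<alpha> y"
  unfolding noise_def using assms tilt_pos[OF assms(1)]
  by (intro cube_mean_pos[where x\<^sub>0 = x] mult_nonneg_nonneg mult_pos_pos) (auto intro: less_imp_le)

lemma noise_eq_0:
  assumes "\<And>x. 0 \<le> \<alpha> x" "cube_mean N \<alpha> = 0"
  shows "noise \<rho> N \<alpha> y = 0"
proof -
  have "\<alpha> x = 0" if "x \<in> cube N" for x
    using cube_mean_pos[of N \<alpha> x] assms that by (auto simp: less_le)
  then have "noise \<rho> N \<alpha> y = cube_mean N (\<lambda>_. 0)"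
    unfolding noise_def by (intro cube_mean_cong) simp
  then show ?thesis by simp
qed

text \<open>Of the first coordinates \<open>(a, b)\<close> of a pair, \<open>a\<close> is revealed and \<open>b\<close> is integrated out.\<close>

definition marginal_tail :: "real \<Rightarrow> bool \<Rightarrow> (bool list \<Rightarrow> real) \<Rightarrow> bool list \<Rightarrow> real" where
  "marginal_tail \<rho> a \<beta> y = bit_mean (\<lambda>b. (1 + \<rho> * spin a * spin b) * \<beta> (b # y))"

lemma marginal_tail_nonneg:
  assumes "\<bar>\<rho>\<bar> < 1" "\<And>y. 0 \<le> \<beta> y"
  shows "0 \<le> marginal_tail \<rho> a \<beta> y"
  unfolding marginal_tail_def using assms one_plus_spin_pos[OF assms(1)]
  by (intro bit_mean_nonneg mult_nonneg_nonneg) (auto intro: less_imp_le)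

lemma marginal_tail_pos:
  assumes "\<bar>\<rho>\<bar> < 1" "\<And>y. 0 \<le> \<beta> y" "0 < \<beta> (b # y)"
  shows "0 < marginal_tail \<rho> a \<beta> y"
  unfolding marginal_tail_def using assms(2,3) one_plus_spin_pos[OF assms(1)]
  by (intro bit_mean_pos[where a = b] mult_nonneg_nonneg mult_pos_pos) (auto intro: less_imp_le)

lemma noise_Cons_right:
  "noise \<rho> (Suc N) \<alpha> (b # y) =
     bit_mean (\<lambda>a. (1 + \<rho> * spin b * spin a) * noise \<rho> N (\<lambda>x. \<alpha> (a # x)) y)"
  by (simp add: noise_def cube_mean_Suc mult_ac flip: cube_mean_cmult)

lemma noise_Cons_left: "noise \<rho> (Suc N) \<beta> (a # x) = noise \<rho> N (marginal_tail \<rho> a \<beta>) x"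
  by (simp add: noise_def marginal_tail_def cube_mean_Suc mult_ac
      flip: cube_mean_bit_mean) (simp add: bit_mean_def algebra_simps)

lemma tilt_mean_Suc_eq:
  assumes "\<And>a b x y. x \<in> cube N \<Longrightarrow> y \<in> cube N \<Longrightarrow> \<alpha> (a # x) \<noteq> 0 \<Longrightarrow> \<beta> (b # y) \<noteq> 0 \<Longrightarrow>
    u (a # x) (b # y) = f a b y + v a x y"
  shows "tilt_mean \<rho> (Suc N) (\<lambda>x y. \<alpha> x * \<beta> y * u x y) =
    cube_mean N (\<lambda>y. bit_mean (\<lambda>a. bit_mean (\<lambda>b. (1 + \<rho> * spin a * spin b) *
      (noise \<rho> N (\<lambda>x. \<alpha> (a # x)) y * \<beta> (b # y) * f a b y))))
    + bit_mean (\<lambda>a. tilt_mean \<rho> N (\<lambda>x y. \<alpha> (a # x) * marginal_tail \<rho> a \<beta> y * v a x y))"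
proof -
  have split: "tilt_mean \<rho> N (\<lambda>x y. \<alpha> (a # x) * \<beta> (b # y) * u (a # x) (b # y)) =
      tilt_mean \<rho> N (\<lambda>x y. \<alpha> (a # x) * (\<beta> (b # y) * f a b y)) +
      tilt_mean \<rho> N (\<lambda>x y. \<alpha> (a # x) * \<beta> (b # y) * v a x y)" for a b
    unfolding tilt_mean_add[symmetric]
  proof (rule tilt_mean_cong)
    fix x y assume "x \<in> cube N" "y \<in> cube N"
    then show "\<alpha> (a # x) * \<beta> (b # y) * u (a # x) (b # y) =
        \<alpha> (a # x) * (\<beta> (b # y) * f a b y) + \<alpha> (a # x) * \<beta> (b # y) * v a x y"
      using assms[of x y a b]
      by (cases "\<alpha> (a # x) = 0"; cases "\<beta> (b # y) = 0") (auto simp: algebra_simps)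
  qed
  have tail: "tilt_mean \<rho> N (\<lambda>x y. \<alpha> (a # x) * marginal_tail \<rho> a \<beta> y * v a x y) =
      bit_mean (\<lambda>b. (1 + \<rho> * spin a * spin b) *
        tilt_mean \<rho> N (\<lambda>x y. \<alpha> (a # x) * \<beta> (b # y) * v a x y))" for a
    unfolding marginal_tail_def tilt_mean_cmult[symmetric] tilt_mean_bit_mean[symmetric]
    by (simp add: bit_mean_def algebra_simps)
  have head: "cube_mean N (\<lambda>y. bit_mean (\<lambda>a. bit_mean (\<lambda>b. (1 + \<rho> * spin a * spin b) *
      (noise \<rho> N (\<lambda>x. \<alpha> (a # x)) y * \<beta> (b # y) * f a b y)))) =
    bit_mean (\<lambda>a. bit_mean (\<lambda>b. (1 + \<rho> * spin a * spin b) *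
      tilt_mean \<rho> N (\<lambda>x y. \<alpha> (a # x) * (\<beta> (b # y) * f a b y))))"
    by (simp only: cube_mean_bit_mean tilt_mean_mult_right cube_mean_cmult mult.assoc)
  show ?thesis
    by (simp only: tilt_mean_Suc split head tail distrib_left bit_mean_add)
qed

text \<open>
  With the weights \<open>\<alpha> x * \<beta> y\<close>, the terms of the first line amount to the information about \<open>x\<close> given
  \<open>y\<close> and about \<open>y\<close> given \<open>x\<close>, and the last term to a divergence. The mean of the second line vanishes
  after summation over the transcripts.
\<close>

definition surplus ::
    "real \<Rightarrow> nat \<Rightarrow> (bool list \<Rightarrow> real) \<Rightarrow> (bool list \<Rightarrow> real) \<Rightarrow> bool list \<Rightarrow> bool list \<Rightarrow> real" where
  "surplus \<rho> N \<alpha> \<beta> x y =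
     8 * \<rho>\<^sup>2 * (ln (\<alpha> x / noise \<rho> N \<alpha> y) + ln (\<beta> y / noise \<rho> N \<beta> x))
     + \<rho> / (1 - \<rho>\<^sup>2) * (corr x y - real N * \<rho>)
     - ln (noise \<rho> N \<alpha> y / cube_mean N \<alpha>)"

lemma surplus_eq_ln_diff:
  assumes "\<bar>\<rho>\<bar> < 1" "\<And>x. 0 \<le> \<alpha> x" "\<And>y. 0 \<le> \<beta> y" "x \<in> cube N" "y \<in> cube N" "0 < \<alpha> x" "0 < \<beta> y"
  shows "surplus \<rho> N \<alpha> \<beta> x y =
    8 * \<rho>\<^sup>2 * ((ln (\<alpha> x) - ln (noise \<rho> N \<alpha> y)) + (ln (\<beta> y) - ln (noise \<rho> N \<beta> x)))
    + \<rho> / (1 - \<rho>\<^sup>2) * (corr x y - real N * \<rho>)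
    - (ln (noise \<rho> N \<alpha> y) - ln (cube_mean N \<alpha>))"
  unfolding surplus_def
  using assms noise_pos[of \<rho> \<alpha> x N y] noise_pos[of \<rho> \<beta> y N x] cube_mean_pos[of N \<alpha> x]
  by (simp add: ln_div)

lemma surplus_Cons:
  fixes \<alpha> \<beta> :: "bool list \<Rightarrow> real"
  assumes \<rho>: "\<bar>\<rho>\<bar> < 1" and \<alpha>: "\<And>x. 0 \<le> \<alpha> x" and \<beta>: "\<And>y. 0 \<le> \<beta> y"
    and xy: "x \<in> cube N" "y \<in> cube N" and pos: "0 < \<alpha> (a # x)" "0 < \<beta> (b # y)"
  defines "g \<equiv> \<lambda>a. noise \<rho> N (\<lambda>x. \<alpha> (a # x)) y" and "h \<equiv> \<lambda>b. \<beta> (b # y)"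
    and "c \<equiv> \<lambda>a. cube_mean N (\<lambda>x. \<alpha> (a # x))"
  shows "surplus \<rho> (Suc N) \<alpha> \<beta> (a # x) (b # y) =
    sign_surplus \<rho> (bias g) (bias h) (bias c) (spin a) (spin b)
    + surplus \<rho> N (\<lambda>x. \<alpha> (a # x)) (marginal_tail \<rho> a \<beta>) x y"
proof -
  have nonneg: "0 \<le> g a" "0 \<le> h a" "0 \<le> c a" for a
    unfolding g_def h_def c_def using \<rho> \<alpha> \<beta> by (auto intro!: noise_nonneg cube_mean_nonneg)
  have pos': "0 < g a" "0 < h b" "0 < c a"
    unfolding g_def h_def c_def
    using \<rho> \<alpha> xy pos by (auto intro!: noise_pos[where x = x] cube_mean_pos[where x\<^sub>0 = x])
  have g: "ln (g a) = ln (bit_mean g) + ln (1 + bias g * spin a)"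
    and h: "ln (h b) = ln (bit_mean h) + ln (1 + bias h * spin b)"
    and c: "ln (c a) = ln (bit_mean c) + ln (1 + bias c * spin a)"
    by (intro ln_eq_ln_bit_mean_bias nonneg pos')+
  have noise_\<alpha>: "ln (noise \<rho> (Suc N) \<alpha> (b # y)) = ln (bit_mean g) + ln (1 + \<rho> * bias g * spin b)"
    unfolding noise_Cons_right
    using ln_bit_mean_correlated[of \<rho> g a b, OF \<rho> nonneg(1) pos'(1)] by (simp add: g_def)
  have tail: "ln (marginal_tail \<rho> a \<beta> y) = ln (bit_mean h) + ln (1 + \<rho> * bias h * spin a)"
    unfolding marginal_tail_def
    using ln_bit_mean_correlated[of \<rho> h b a, OF \<rho> nonneg(2) pos'(2)] by (simp add: h_def)
  have surplus_tail: "surplus \<rho> N (\<lambda>x. \<alpha> (a # x)) (marginal_tail \<rho> a \<beta>) x y =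
    8 * \<rho>\<^sup>2 * ((ln (\<alpha> (a # x)) - ln (g a))
      + (ln (marginal_tail \<rho> a \<beta> y) - ln (noise \<rho> N (marginal_tail \<rho> a \<beta>) x)))
    + \<rho> / (1 - \<rho>\<^sup>2) * (corr x y - real N * \<rho>) - (ln (g a) - ln (c a))"
    unfolding g_def c_def using pos \<alpha> \<beta> xy
    by (intro surplus_eq_ln_diff \<rho> marginal_tail_nonneg marginal_tail_pos[where b = b]) auto
  have surplus_Suc: "surplus \<rho> (Suc N) \<alpha> \<beta> (a # x) (b # y) =
    8 * \<rho>\<^sup>2 * ((ln (\<alpha> (a # x)) - ln (noise \<rho> (Suc N) \<alpha> (b # y)))
      + (ln (h b) - ln (noise \<rho> N (marginal_tail \<rho> a \<beta>) x)))
    + \<rho> / (1 - \<rho>\<^sup>2) * (spin a * spin b + corr x y - real (Suc N) * \<rho>)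
    - (ln (noise \<rho> (Suc N) \<alpha> (b # y)) - ln (bit_mean c))"
    unfolding h_def c_def using pos \<alpha> \<beta> xy \<rho>
    by (subst surplus_eq_ln_diff) (auto simp: cube_def noise_Cons_left cube_mean_Suc)
  define \<kappa> where "\<kappa> = \<rho> / (1 - \<rho>\<^sup>2)"
  show ?thesis
    unfolding surplus_Suc surplus_tail sign_surplus_def g h c noise_\<alpha> tail \<kappa>_def[symmetric]
    by (simp add: algebra_simps)
qed

lemma bit_mean_sign_surplus_nonneg:
  assumes \<rho>: "0 \<le> \<rho>" "\<rho> \<le> 1 / 100" and g: "\<And>a. 0 \<le> g a" and h: "\<And>b. 0 \<le> h b" and c: "\<And>a. 0 \<le> c a"
    and abs_cont: "\<And>a. c a = 0 \<Longrightarrow> g a = 0"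
  shows "0 \<le> bit_mean (\<lambda>a. bit_mean (\<lambda>b. (1 + \<rho> * spin a * spin b) *
    (g a * h b * sign_surplus \<rho> (bias g) (bias h) (bias c) (spin a) (spin b))))"
proof (cases "bit_mean g = 0")
  case False
  have "0 \<le> sign_mean \<rho> (bias g) (bias h) (sign_surplus \<rho> (bias g) (bias h) (bias c))"
  proof (intro sign_mean_sign_surplus_nonneg \<rho> abs_bias_le_1 g h c)
    fix x assume x: "\<bar>x\<bar> = 1" "1 + bias c * x = 0"
    then obtain a where a: "x = spin a" by (metis abs_eq_iff abs_1 spin_simps)
    then have "c a = 0" using eq_bit_mean_bias[of c a, OF c] x(2) by simp
    then show "1 + bias g * x = 0"
      using eq_bit_mean_bias[of g a, OF g] abs_cont False a by simp
  qed
  then show ?thesis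
    unfolding bit_mean_eq_sign_mean[of g h, OF g h]
    by (intro mult_nonneg_nonneg bit_mean_nonneg g h)
qed (simp add: bit_mean_eq_sign_mean[of g h, OF g h])

lemma tilt_mean_surplus_nonneg:
  assumes \<rho>: "0 \<le> \<rho>" "\<rho> \<le> 1 / 100" and "\<And>x. 0 \<le> \<alpha> x" "\<And>y. 0 \<le> \<beta> y"
  shows "0 \<le> tilt_mean \<rho> N (\<lambda>x y. \<alpha> x * \<beta> y * surplus \<rho> N \<alpha> \<beta> x y)"
  using assms(3,4)
proof (induction N arbitrary: \<alpha> \<beta>)
  case 0
  then show ?case
    by (cases "\<alpha> [] = 0"; cases "\<beta> [] = 0") (simp_all add: surplus_def noise_def)
next
  case (Suc N)
  have \<rho>1: "\<bar>\<rho>\<bar> < 1" using \<rho> by simp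
  define g where "g y a = noise \<rho> N (\<lambda>x. \<alpha> (a # x)) y" for y a
  define h where "h y b = \<beta> (b # y)" for y b
  define c where "c a = cube_mean N (\<lambda>x. \<alpha> (a # x))" for a
  have nonneg: "0 \<le> g y a" "0 \<le> h y a" "0 \<le> c a" for y a
    unfolding g_def h_def c_def using \<rho>1 Suc.prems by (auto intro!: noise_nonneg cube_mean_nonneg)
  have "tilt_mean \<rho> (Suc N) (\<lambda>x y. \<alpha> x * \<beta> y * surplus \<rho> (Suc N) \<alpha> \<beta> x y) =
      cube_mean N (\<lambda>y. bit_mean (\<lambda>a. bit_mean (\<lambda>b. (1 + \<rho> * spin a * spin b) *
        (g y a * h y b * sign_surplus \<rho> (bias (g y)) (bias (h y)) (bias c) (spin a) (spin b)))))
      + bit_mean (\<lambda>a. tilt_mean \<rho> N (\<lambda>x y. \<alpha> (a # x) * marginal_tail \<rho> a \<beta> y *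
        surplus \<rho> N (\<lambda>x. \<alpha> (a # x)) (marginal_tail \<rho> a \<beta>) x y))"
    unfolding g_def h_def c_def
    using Suc.prems by (intro tilt_mean_Suc_eq surplus_Cons \<rho>1) (auto simp: less_le)
  also have "\<dots> \<ge> 0"
  proof (intro add_nonneg_nonneg cube_mean_nonneg)
    show "0 \<le> bit_mean (\<lambda>a. tilt_mean \<rho> N (\<lambda>x y. \<alpha> (a # x) * marginal_tail \<rho> a \<beta> y *
        surplus \<rho> N (\<lambda>x. \<alpha> (a # x)) (marginal_tail \<rho> a \<beta>) x y))"
      by (intro bit_mean_nonneg Suc.IH Suc.prems marginal_tail_nonneg \<rho>1)
  next
    fix y
    show "0 \<le> bit_mean (\<lambda>a. bit_mean (\<lambda>b. (1 + \<rho> * spin a * spin b) *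
        (g y a * h y b * sign_surplus \<rho> (bias (g y)) (bias (h y)) (bias c) (spin a) (spin b))))"
      using nonneg Suc.prems
      by (intro bit_mean_sign_surplus_nonneg \<rho>) (auto simp: g_def c_def noise_eq_0)
  qed
  finally show ?case .
qed

lemma cube_mean_log_sum_inequality:
  assumes "\<And>y. 0 \<le> u y" "\<And>y. 0 \<le> v y" "\<And>y. v y = 0 \<Longrightarrow> u y = 0"
  shows "cube_mean N u * ln (cube_mean N u / cube_mean N v) \<le>
    cube_mean N (\<lambda>y. u y * ln (u y / v y))"
  using log_sum_inequality[of "cube N" u v] assms
  by (simp add: cube_mean_def divide_right_mono)

lemma tilt_mean_ln_noise_ge:
  fixes N :: nat and \<rho> :: real and \<alpha> \<beta> :: "bool list \<Rightarrow> real"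
  assumes \<rho>: "\<bar>\<rho>\<bar> < 1" and \<alpha>: "\<And>x. 0 \<le> \<alpha> x" and \<beta>: "\<And>y. 0 \<le> \<beta> y"
  defines "Q \<equiv> tilt_mean \<rho> N (\<lambda>x y. \<alpha> x * \<beta> y)"
  shows "Q * ln (Q / (cube_mean N \<alpha> * cube_mean N \<beta>)) \<le>
    tilt_mean \<rho> N (\<lambda>x y. \<alpha> x * \<beta> y * ln (noise \<rho> N \<alpha> y / cube_mean N \<alpha>))"
proof -
  let ?S = "noise \<rho> N \<alpha>" and ?A = "cube_mean N \<alpha>"
  have "Q = cube_mean N (\<lambda>y. ?S y * \<beta> y)"
    unfolding Q_def by (rule tilt_mean_mult_right)
  then have "Q * ln (Q / (?A * cube_mean N \<beta>)) \<le>
      cube_mean N (\<lambda>y. ?S y * \<beta> y * ln (?S y * \<beta> y / (?A * \<beta> y)))"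
    using cube_mean_log_sum_inequality[of "\<lambda>y. ?S y * \<beta> y" "\<lambda>y. ?A * \<beta> y" N]
    by (simp add: cube_mean_cmult noise_nonneg \<rho> \<alpha> \<beta> cube_mean_nonneg) (metis noise_eq_0 \<alpha>)
  also have "\<dots> = cube_mean N (\<lambda>y. ?S y * (\<beta> y * ln (?S y / ?A)))"
  proof (rule cube_mean_cong)
    show "?S y * \<beta> y * ln (?S y * \<beta> y / (?A * \<beta> y)) = ?S y * (\<beta> y * ln (?S y / ?A))" for y
      by (cases "\<beta> y = 0") simp_all
  qed
  finally show ?thesis
    by (simp add: mult.assoc flip: tilt_mean_mult_right)
qed

lemma weighted_surplus_eq:
  fixes \<alpha> \<beta> :: "bool list \<Rightarrow> real"
  assumes \<rho>: "\<bar>\<rho>\<bar> < 1" and \<alpha>: "\<And>x. 0 \<le> \<alpha> x" and \<beta>: "\<And>y. 0 \<le> \<beta> y" and xy: "x \<in> cube N" "y \<in> cube N"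
  defines "w \<equiv> \<alpha> x * \<beta> y"
  shows "w * surplus \<rho> N \<alpha> \<beta> x y =
    8 * \<rho>\<^sup>2 * (w * ln (w / (cube_mean N \<alpha> * cube_mean N \<beta>))
      - w * ln (noise \<rho> N \<alpha> y / cube_mean N \<alpha>) - w * ln (noise \<rho> N \<beta> x / cube_mean N \<beta>))
    + \<rho> / (1 - \<rho>\<^sup>2) * (w * (corr x y - real N * \<rho>))
    - w * ln (noise \<rho> N \<alpha> y / cube_mean N \<alpha>)"
proof (cases "\<alpha> x = 0 \<or> \<beta> y = 0")
  case False
  then have pos: "\<alpha> x > 0" "\<beta> y > 0" using \<alpha>[of x] \<beta>[of y] by (auto simp: less_le)
  have "ln (\<alpha> x / noise \<rho> N \<alpha> y) + ln (\<beta> y / noise \<rho> N \<beta> x) =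
      ln (w / (cube_mean N \<alpha> * cube_mean N \<beta>))
      - ln (noise \<rho> N \<alpha> y / cube_mean N \<alpha>) - ln (noise \<rho> N \<beta> x / cube_mean N \<beta>)"
    using pos noise_pos[of \<rho> \<alpha> x N y] noise_pos[of \<rho> \<beta> y N x]
      cube_mean_pos[of N \<alpha> x] cube_mean_pos[of N \<beta> y] \<rho> \<alpha> \<beta> xy
    by (simp add: w_def ln_div ln_mult)
  moreover define \<kappa> where "\<kappa> = \<rho> / (1 - \<rho>\<^sup>2)"
  ultimately show ?thesis
    unfolding surplus_def \<kappa>_def[symmetric] by (simp only:) (simp add: algebra_simps)
qed (auto simp: w_def)

lemma rectangle_divergence_le:
  fixes N :: nat and \<rho> :: real and \<alpha> \<beta> :: "bool list \<Rightarrow> real"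
  assumes \<rho>: "0 \<le> \<rho>" "\<rho> \<le> 1 / 100" and \<alpha>: "\<And>x. 0 \<le> \<alpha> x" and \<beta>: "\<And>y. 0 \<le> \<beta> y"
  defines "P \<equiv> cube_mean N \<alpha> * cube_mean N \<beta>" and "Q \<equiv> tilt_mean \<rho> N (\<lambda>x y. \<alpha> x * \<beta> y)"
  shows "Q * ln (Q / P) \<le>
    8 * \<rho>\<^sup>2 * (tilt_mean \<rho> N (\<lambda>x y. \<alpha> x * \<beta> y * ln (\<alpha> x * \<beta> y / P)) - 2 * (Q * ln (Q / P)))
    + \<rho> / (1 - \<rho>\<^sup>2) * tilt_mean \<rho> N (\<lambda>x y. \<alpha> x * \<beta> y * (corr x y - real N * \<rho>))"
proof -
  have \<rho>1: "\<bar>\<rho>\<bar> < 1" using \<rho> by simp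
  define I where "I = tilt_mean \<rho> N (\<lambda>x y. \<alpha> x * \<beta> y * ln (\<alpha> x * \<beta> y / P))"
  define L where "L = tilt_mean \<rho> N (\<lambda>x y. \<alpha> x * \<beta> y * ln (noise \<rho> N \<alpha> y / cube_mean N \<alpha>))"
  define R where "R = tilt_mean \<rho> N (\<lambda>x y. \<alpha> x * \<beta> y * ln (noise \<rho> N \<beta> x / cube_mean N \<beta>))"
  define C where "C = tilt_mean \<rho> N (\<lambda>x y. \<alpha> x * \<beta> y * (corr x y - real N * \<rho>))"
  have L: "Q * ln (Q / P) \<le> L"
    unfolding Q_def P_def L_def by (rule tilt_mean_ln_noise_ge[OF \<rho>1 \<alpha> \<beta>])
  have R: "Q * ln (Q / P) \<le> R"
    using tilt_mean_ln_noise_ge[of \<rho> \<beta> \<alpha> N, OF \<rho>1 \<beta> \<alpha>]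
      tilt_mean_commute[of \<rho> N "\<lambda>x y. \<beta> x * \<alpha> y"]
      tilt_mean_commute[of \<rho> N "\<lambda>x y. \<beta> x * \<alpha> y * ln (noise \<rho> N \<beta> y / cube_mean N \<beta>)"]
    unfolding Q_def P_def R_def by (simp add: mult_ac)
  have "tilt_mean \<rho> N (\<lambda>x y. \<alpha> x * \<beta> y * surplus \<rho> N \<alpha> \<beta> x y) =
      8 * \<rho>\<^sup>2 * (I - L - R) + \<rho> / (1 - \<rho>\<^sup>2) * C - L"
    unfolding I_def L_def R_def C_def P_def
      tilt_mean_diff[symmetric] tilt_mean_cmult[symmetric] tilt_mean_add[symmetric]
    by (intro tilt_mean_cong weighted_surplus_eq \<rho>1 \<alpha> \<beta>)
  then have "0 \<le> 8 * \<rho>\<^sup>2 * (I - L - R) + \<rho> / (1 - \<rho>\<^sup>2) * C - L"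
    using tilt_mean_surplus_nonneg[where \<alpha> = \<alpha> and \<beta> = \<beta> and N = N, OF \<rho> \<alpha> \<beta>] by simp
  moreover have "8 * \<rho>\<^sup>2 * (I - L - R) \<le> 8 * \<rho>\<^sup>2 * (I - 2 * (Q * ln (Q / P)))"
    using L R by (intro mult_left_mono) auto
  ultimately show ?thesis
    using L unfolding I_def C_def by linarith
qed

section \<open>Two-party transcripts\<close>

text \<open>The number of indices at which \<open>x\<close> and \<open>y\<close> differ deviates from \<open>N / 2\<close> by \<open>\<bar>corr x y\<bar> / 2\<close>.\<close>

definition gap_answer :: "nat \<Rightarrow> bool \<Rightarrow> bool list \<Rightarrow> bool list \<Rightarrow> bool" where
  "gap_answer N v x y \<longleftrightarrow>
     (if v then 4 * sqrt (real N) \<le> \<bar>corr x y\<bar> else \<bar>corr x y\<bar> \<le> 2 * sqrt (real N))"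

lemma ln_2_mult_prob_le_divergence:
  fixes p q :: "'a \<Rightarrow> real"
  assumes "finite T" and nonneg: "\<And>t. 0 \<le> p t" "\<And>t. 0 \<le> q t" and abs_cont: "\<And>t. p t = 0 \<Longrightarrow> q t = 0"
    and total: "sum q T = 1" "sum p T = 1"
  shows "ln 2 * (\<Sum>t\<in>T. q t * of_bool (E t)) \<le>
    (\<Sum>t\<in>T. q t * ln (q t / p t)) + (\<Sum>t\<in>T. p t * of_bool (E t))"
proof -
  define e :: real where "e = (\<Sum>t\<in>T. p t * of_bool (E t))"
  have e: "0 \<le> e" unfolding e_def using nonneg by (intro sum_nonneg) simp
  have "(\<Sum>t\<in>T. p t * (1 + of_bool (E t))) = 1 + e"
    by (simp add: e_def distrib_left sum.distrib total)
  then have "- ln (1 + e) = sum q T * ln (sum q T / (\<Sum>t\<in>T. p t * (1 + of_bool (E t))))"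
    using e by (simp add: total ln_div)
  also have "\<dots> \<le> (\<Sum>t\<in>T. q t * ln (q t / (p t * (1 + of_bool (E t)))))"
    using nonneg abs_cont \<open>finite T\<close>
    by (intro log_sum_inequality) (auto simp: of_bool_def split: if_splits)
  also have "\<dots> = (\<Sum>t\<in>T. q t * ln (q t / p t) - ln 2 * (q t * of_bool (E t)))"
  proof (rule sum.cong[OF refl])
    fix t
    show "q t * ln (q t / (p t * (1 + of_bool (E t)))) =
        q t * ln (q t / p t) - ln 2 * (q t * of_bool (E t))"
    proof (cases "q t = 0")
      case False
      then have "q t > 0" "p t > 0" using nonneg[of t] abs_cont[of t] by (auto simp: less_le)
      then show ?thesis by (auto simp: ln_div ln_mult algebra_simps)
    qed simp
  qed
  also have "\<dots> = (\<Sum>t\<in>T. q t * ln (q t / p t)) - ln 2 * (\<Sum>t\<in>T. q t * of_bool (E t))"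
    by (simp add: sum_subtractf sum_distrib_left)
  finally show ?thesis
    using ln_add_one_self_le_self[OF e] unfolding e_def by linarith
qed

locale two_party =
  fixes T :: "'t set" and a b :: "'t \<Rightarrow> bool list \<Rightarrow> real" and N :: nat
  assumes finite_T: "finite T"
    and a_nonneg: "\<And>t x. 0 \<le> a t x" and b_nonneg: "\<And>t y. 0 \<le> b t y"
    and sum_ab: "\<And>x y. x \<in> cube N \<Longrightarrow> y \<in> cube N \<Longrightarrow> (\<Sum>t\<in>T. a t x * b t y) = 1"
begin

definition transcript_prob :: "real \<Rightarrow> 't \<Rightarrow> real" where
  "transcript_prob \<rho> t = tilt_mean \<rho> N (\<lambda>x y. a t x * b t y)"

definition divergence :: "bool list \<Rightarrow> bool list \<Rightarrow> real" where
  "divergence x y = (\<Sum>t\<in>T. a t x * b t y * ln (a t x * b t y / transcript_prob 0 t))"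

definition info :: real where
  "info = tilt_mean 0 N divergence"

definition tilt_divergence :: "real \<Rightarrow> real" where
  "tilt_divergence \<rho> = (\<Sum>t\<in>T. transcript_prob \<rho> t * ln (transcript_prob \<rho> t / transcript_prob 0 t))"

definition output_prob :: "real \<Rightarrow> ('t \<Rightarrow> bool) \<Rightarrow> bool \<Rightarrow> real" where
  "output_prob \<rho> out v = (\<Sum>t\<in>T. transcript_prob \<rho> t * of_bool (out t = v))"

definition cond_error :: "('t \<Rightarrow> bool) \<Rightarrow> bool list \<Rightarrow> bool list \<Rightarrow> real" where
  "cond_error out x y = (\<Sum>t\<in>T. a t x * b t y * of_bool (gap_answer N (\<not> out t) x y))"

definition error_rate :: "real \<Rightarrow> ('t \<Rightarrow> bool) \<Rightarrow> real" where
  "error_rate \<rho> out = tilt_mean \<rho> N (cond_error out)"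

lemma ab_nonneg: "0 \<le> a t x * b t y"
  using a_nonneg b_nonneg by simp

lemma transcript_prob_nonneg: "\<bar>\<rho>\<bar> < 1 \<Longrightarrow> 0 \<le> transcript_prob \<rho> t"
  unfolding transcript_prob_def by (intro tilt_mean_nonneg ab_nonneg)

lemma transcript_prob_0: "transcript_prob 0 t = cube_mean N (a t) * cube_mean N (b t)"
  by (simp add: transcript_prob_def tilt_mean_mult_right noise_def cube_mean_cmult)

lemma ab_le_transcript_prob:
  assumes "x \<in> cube N" "y \<in> cube N"
  shows "a t x * b t y \<le> 4 ^ N * transcript_prob 0 t"
proof -
  have "a t x * b t y \<le> (\<Sum>x\<in>cube N. a t x) * (\<Sum>y\<in>cube N. b t y)"
    using assms a_nonneg b_nonneg by (intro mult_mono member_le_sum sum_nonneg) auto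
  also have "\<dots> = 4 ^ N * transcript_prob 0 t"
    by (simp add: transcript_prob_0 cube_mean_def flip: power_mult_distrib)
  finally show ?thesis .
qed

lemma ab_eq_0:
  assumes "transcript_prob 0 t = 0" "x \<in> cube N" "y \<in> cube N"
  shows "a t x * b t y = 0"
  using ab_le_transcript_prob[OF assms(2,3), of t] ab_nonneg[of t x y] assms(1) by simp

lemma transcript_prob_eq_0:
  assumes "transcript_prob 0 t = 0"
  shows "transcript_prob \<rho> t = 0"
proof -
  have "transcript_prob \<rho> t = tilt_mean \<rho> N (\<lambda>_ _. 0)"
    unfolding transcript_prob_def using ab_eq_0[OF assms] by (rule tilt_mean_cong)
  then show ?thesis by simp
qed

lemma sum_tilt_mean_ab: "(\<Sum>t\<in>T. tilt_mean \<rho> N (\<lambda>x y. a t x * b t y * f x y)) = tilt_mean \<rho> N f"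
proof -
  have "(\<Sum>t\<in>T. a t x * b t y * f x y) = f x y" if "x \<in> cube N" "y \<in> cube N" for x y
    using sum_ab[OF that] by (simp flip: sum_distrib_right)
  then show ?thesis
    unfolding tilt_mean_sum[symmetric] by (rule tilt_mean_cong)
qed

lemma sum_transcript_prob: "sum (transcript_prob \<rho>) T = 1"
  using sum_tilt_mean_ab[of \<rho> "\<lambda>_ _. 1"] by (simp add: transcript_prob_def)

lemma divergence_nonneg:
  assumes "x \<in> cube N" "y \<in> cube N"
  shows "0 \<le> divergence x y"
  using gibbs_inequality[of T "\<lambda>t. a t x * b t y" "transcript_prob 0"] ab_eq_0 assms finite_T ab_nonneg transcript_prob_nonneg sum_ab sum_transcript_prob
  by (simp add: divergence_def)

lemma divergence_le:
  assumes "x \<in> cube N" "y \<in> cube N"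
  shows "divergence x y \<le> real N * ln 4"
proof -
  have "divergence x y \<le> (\<Sum>t\<in>T. a t x * b t y * (real N * ln 4))"
    unfolding divergence_def
  proof (intro sum_mono)
    fix t
    show "a t x * b t y * ln (a t x * b t y / transcript_prob 0 t) \<le>
        a t x * b t y * (real N * ln 4)"
    proof (cases "a t x * b t y = 0")
      case False
      then have pos: "0 < a t x * b t y" "0 < transcript_prob 0 t"
        using ab_nonneg[of t x y] ab_eq_0[OF _ assms] transcript_prob_nonneg[of 0 t]
        by (auto simp: less_le)
      then have "ln (a t x * b t y / transcript_prob 0 t) \<le> ln (4 ^ N)"
        using ab_le_transcript_prob[OF assms, of t]
        by (subst ln_le_cancel_iff) (auto simp: field_simps)
      then show ?thesis using pos(1) by (intro mult_left_mono) (auto simp: ln_realpow)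
    qed auto
  qed
  also have "\<dots> = real N * ln 4" using sum_ab[OF assms] by (simp flip: sum_distrib_right)
  finally show ?thesis .
qed

lemma info_nonneg: "0 \<le> info"
  unfolding info_def by (intro tilt_mean_nonneg divergence_nonneg) simp_all

lemma info_le: "info \<le> real N * ln 4"
  using tilt_mean_mono[of 0 N divergence "\<lambda>_ _. real N * ln 4"] divergence_le
  by (simp add: info_def)

lemma tilt_divergence_nonneg: "\<bar>\<rho>\<bar> < 1 \<Longrightarrow> 0 \<le> tilt_divergence \<rho>"
  using gibbs_inequality[of T "transcript_prob \<rho>" "transcript_prob 0"] finite_T
  by (simp add: tilt_divergence_def transcript_prob_nonneg transcript_prob_eq_0 sum_transcript_prob)

lemma tilt_divergence_le:
  assumes \<rho>: "0 \<le> \<rho>" "\<rho> \<le> 1 / 100"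
  shows "tilt_divergence \<rho> \<le> 8 * \<rho>\<^sup>2 * tilt_mean \<rho> N divergence"
proof -
  define D where "D t = transcript_prob \<rho> t * ln (transcript_prob \<rho> t / transcript_prob 0 t)" for t
  define I where
    "I t = tilt_mean \<rho> N (\<lambda>x y. a t x * b t y * ln (a t x * b t y / transcript_prob 0 t))" for t
  define C where "C t = tilt_mean \<rho> N (\<lambda>x y. a t x * b t y * (corr x y - real N * \<rho>))" for t
  have "D t \<le> 8 * \<rho>\<^sup>2 * (I t - 2 * D t) + \<rho> / (1 - \<rho>\<^sup>2) * C t" for t
    unfolding D_def I_def C_def transcript_prob_0 transcript_prob_def[of \<rho>]
    using a_nonneg b_nonneg by (intro rectangle_divergence_le \<rho>)
  then have "sum D T \<le> (\<Sum>t\<in>T. 8 * \<rho>\<^sup>2 * (I t - 2 * D t) + \<rho> / (1 - \<rho>\<^sup>2) * C t)"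
    by (rule sum_mono)
  also have "\<dots> = 8 * \<rho>\<^sup>2 * (sum I T - 2 * sum D T) + \<rho> / (1 - \<rho>\<^sup>2) * sum C T"
    by (simp only: sum.distrib sum_subtractf flip: sum_distrib_left)
  also have "sum C T = 0"
    unfolding C_def sum_tilt_mean_ab by (rule tilt_mean_corr)
  also have "sum I T = tilt_mean \<rho> N divergence"
    unfolding I_def divergence_def tilt_mean_sum ..
  finally have "sum D T \<le> 8 * \<rho>\<^sup>2 * tilt_mean \<rho> N divergence - 16 * \<rho>\<^sup>2 * sum D T"
    by (simp add: algebra_simps)
  moreover have "0 \<le> sum D T"
    using tilt_divergence_nonneg[of \<rho>] \<rho> by (simp add: D_def tilt_divergence_def)
  then have "0 \<le> 16 * \<rho>\<^sup>2 * sum D T" by simp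
  ultimately show ?thesis
    unfolding tilt_divergence_def D_def[symmetric] by linarith
qed

lemma cond_error_bounds:
  assumes "x \<in> cube N" "y \<in> cube N"
  shows "0 \<le> cond_error out x y \<and> cond_error out x y \<le> 1"
proof
  show "0 \<le> cond_error out x y"
    unfolding cond_error_def using ab_nonneg by (simp add: sum_nonneg)
  have "cond_error out x y \<le> (\<Sum>t\<in>T. a t x * b t y)"
    unfolding cond_error_def using ab_nonneg by (intro sum_mono) simp
  then show "cond_error out x y \<le> 1" using sum_ab[OF assms] by simp
qed

lemma error_rate_nonneg: "\<bar>\<rho>\<bar> < 1 \<Longrightarrow> 0 \<le> error_rate \<rho> out"
  unfolding error_rate_def using cond_error_bounds by (intro tilt_mean_nonneg) auto

lemma error_rate_le_1: "\<bar>\<rho>\<bar> < 1 \<Longrightarrow> error_rate \<rho> out \<le> 1"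
  unfolding error_rate_def using tilt_mean_mono[of \<rho> N _ "\<lambda>_ _. 1"] cond_error_bounds by simp

lemma output_prob_eq:
  "output_prob \<rho> out v = tilt_mean \<rho> N (\<lambda>x y. \<Sum>t\<in>T. a t x * b t y * of_bool (out t = v))"
  unfolding output_prob_def transcript_prob_def tilt_mean_sum
  using tilt_mean_cmult[of \<rho> N "of_bool _"] by (simp add: mult.commute)

lemma output_prob_True: "output_prob \<rho> out True = 1 - output_prob \<rho> out False"
proof -
  have "output_prob \<rho> out True + output_prob \<rho> out False = sum (transcript_prob \<rho>) T"
    unfolding output_prob_def sum.distrib[symmetric] by (intro sum.cong) auto
  then show ?thesis by (simp add: sum_transcript_prob)
qed

lemma output_prob_le:
  assumes "\<bar>\<rho>\<bar> < 1"
  shows "output_prob \<rho> out v \<le>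
    error_rate \<rho> out + tilt_mean \<rho> N (\<lambda>x y. of_bool (\<not> gap_answer N (\<not> v) x y))"
  unfolding output_prob_eq error_rate_def tilt_mean_add[symmetric]
proof (rule tilt_mean_mono[OF assms])
  fix x y assume xy: "x \<in> cube N" "y \<in> cube N"
  have "(\<Sum>t\<in>T. a t x * b t y * of_bool (out t = v)) \<le>
      (\<Sum>t\<in>T. a t x * b t y * of_bool (gap_answer N (\<not> out t) x y)
        + a t x * b t y * of_bool (\<not> gap_answer N (\<not> v) x y))"
    using ab_nonneg by (intro sum_mono) auto
  also have "\<dots> = cond_error out x y + of_bool (\<not> gap_answer N (\<not> v) x y)"
    by (simp only: sum.distrib cond_error_def sum_ab[OF xy] mult_1 flip: sum_distrib_right)
  finally show "(\<Sum>t\<in>T. a t x * b t y * of_bool (out t = v)) \<le>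
      cond_error out x y + of_bool (\<not> gap_answer N (\<not> v) x y)" .
qed

lemma output_prob_uniform_le:
  assumes "N > 0"
  shows "output_prob 0 out True \<le> error_rate 0 out + 1 / 4"
proof -
  have "tilt_mean 0 N (\<lambda>x y. of_bool (\<not> gap_answer N (\<not> True) x y)) \<le>
      tilt_mean 0 N (\<lambda>x y. of_bool (2 * sqrt (real N) \<le> \<bar>corr x y - real N * 0\<bar>))"
    by (intro tilt_mean_mono) (auto simp: gap_answer_def)
  also have "\<dots> \<le> real N / (2 * sqrt (real N))\<^sup>2"
    using assms by (intro tilt_mean_corr_deviation_le) auto
  also have "\<dots> = 1 / 4" using assms by (simp add: power_mult_distrib)
  finally show ?thesis using output_prob_le[of 0 out True] by simp
qed

text \<open>The correlation \<open>8 / sqrt N\<close> moves the mean of \<open>corr\<close> to \<open>8 * sqrt N\<close>, twice the threshold.\<close>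

lemma output_prob_tilted_ge:
  assumes \<rho>: "\<rho> = 8 / sqrt (real N)" "\<rho> < 1" and N: "N > 0"
  shows "1 - error_rate \<rho> out - 1 / 16 \<le> output_prob \<rho> out True"
proof -
  have \<rho>1: "\<bar>\<rho>\<bar> < 1" using \<rho> by simp
  have "real N * \<rho> = 8 * (real N / sqrt (real N))" by (simp add: \<rho>(1))
  also have "\<dots> = 8 * sqrt (real N)" by (simp only: real_div_sqrt of_nat_0_le_iff)
  finally have "tilt_mean \<rho> N (\<lambda>x y. of_bool (\<not> gap_answer N (\<not> False) x y)) \<le>
      tilt_mean \<rho> N (\<lambda>x y. of_bool (4 * sqrt (real N) \<le> \<bar>corr x y - real N * \<rho>\<bar>))"
    by (intro tilt_mean_mono \<rho>1) (auto simp: gap_answer_def)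
  also have "\<dots> \<le> real N / (4 * sqrt (real N))\<^sup>2"
    using N by (intro tilt_mean_corr_deviation_le \<rho>1) auto
  also have "\<dots> = 1 / 16" using N by (simp add: power_mult_distrib)
  finally show ?thesis
    using output_prob_le[OF \<rho>1, of out False] by (simp add: output_prob_True)
qed

lemma ln_2_mult_output_prob_le:
  assumes "\<bar>\<rho>\<bar> < 1"
  shows "ln 2 * output_prob \<rho> out True \<le> tilt_divergence \<rho> + output_prob 0 out True"
  using ln_2_mult_prob_le_divergence[of T "transcript_prob 0" "transcript_prob \<rho>"
      "\<lambda>t. out t = True"]
    finite_T assms transcript_prob_nonneg transcript_prob_eq_0 sum_transcript_prob
  by (simp add: output_prob_def tilt_divergence_def)

lemma tilt_divergence_ge:
  assumes \<rho>: "\<rho> = 8 / sqrt (real N)" "\<rho> < 1" and N: "N > 0"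
    and err: "error_rate 0 out \<le> 1 / (10 ^ 6 * exp 64)"
  shows "3 / 10 \<le> tilt_divergence \<rho>"
proof -
  have \<rho>1: "\<bar>\<rho>\<bar> < 1" using \<rho> by simp
  define K :: real where "K = 10 ^ 4 * exp 64"
  have "real N * \<rho>\<^sup>2 = 64" using N by (simp add: \<rho>(1) power_divide)
  then have "error_rate \<rho> out \<le> K * error_rate 0 out + 1 * exp 64 / K"
    using tilt_mean_le_uniform_mean[of \<rho> K N "cond_error out" 1] \<rho>1 cond_error_bounds
    by (simp add: K_def error_rate_def)
  also have "\<dots> \<le> K * (1 / (10 ^ 6 * exp 64)) + 1 * exp 64 / K"
    using err by (intro add_right_mono mult_left_mono) (simp_all add: K_def)
  also have "\<dots> \<le> 11 / 1000" by (simp add: K_def)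
  finally have "9 / 10 \<le> output_prob \<rho> out True"
    using output_prob_tilted_ge[OF \<rho> N, of out] by simp
  then have "2 / 3 * (9 / 10) \<le> ln 2 * output_prob \<rho> out True"
    using ln2_ge_two_thirds by (intro mult_mono) auto
  also have "\<dots> \<le> tilt_divergence \<rho> + output_prob 0 out True"
    by (rule ln_2_mult_output_prob_le[OF \<rho>1])
  also have "output_prob 0 out True \<le> 3 / 10"
  proof -
    have "20 * 1 \<le> (10 ^ 6 * exp 64 :: real)" by (intro mult_mono) auto
    then have "1 / (10 ^ 6 * exp 64) \<le> (1 / 20 :: real)" by (intro divide_left_mono) auto
    then show ?thesis using output_prob_uniform_le[OF N, of out] err by linarith
  qed
  finally show ?thesis by simp
qed

lemma info_ge_if_error_le:
  assumes N: "N \<ge> 640000" and err: "error_rate 0 out \<le> 1 / (10 ^ 6 * exp 64)"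
  shows "real N / (10 ^ 8 * exp 64) \<le> info"
proof -
  define \<rho> where "\<rho> = 8 / sqrt (real N)"
  define K :: real where "K = 10 ^ 4 * exp 64"
  have "sqrt (800\<^sup>2) \<le> sqrt (real N)" using N by (intro real_sqrt_le_mono) simp
  then have "8 / sqrt (real N) \<le> 8 / 800" using N by (intro divide_left_mono) auto
  then have \<rho>: "0 \<le> \<rho>" "\<rho> \<le> 1 / 100" "\<rho> < 1" unfolding \<rho>_def by auto
  have \<rho>2: "real N * \<rho>\<^sup>2 = 64" "\<rho>\<^sup>2 = 64 / real N"
    unfolding \<rho>_def using N by (simp_all add: power_divide)
  have ln_4: "ln (4::real) \<le> 2" using ln_2_less_1 ln_realpow[of 2 2] by simp
  have "tilt_mean \<rho> N divergence \<le> K * info + real N * ln 4 * exp (real N * \<rho>\<^sup>2) / K"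
    unfolding info_def using \<rho> divergence_nonneg divergence_le
    by (intro tilt_mean_le_uniform_mean) (auto simp: K_def)
  also have "\<dots> \<le> K * info + real N * (2 / 10 ^ 4)"
    using mult_left_mono[OF ln_4, of "real N"] unfolding \<rho>2 K_def by simp
  finally have "8 * \<rho>\<^sup>2 * tilt_mean \<rho> N divergence \<le> 8 * \<rho>\<^sup>2 * (K * info + real N * (2 / 10 ^ 4))"
    by (intro mult_left_mono) auto
  then have "3 / 10 \<le> 8 * \<rho>\<^sup>2 * (K * info + real N * (2 / 10 ^ 4))"
    using tilt_divergence_ge[OF \<rho>_def \<rho>(3) _ err] tilt_divergence_le[OF \<rho>(1,2)] N by linarith
  then have "real N / 10 ^ 4 \<le> K * info"
    using N unfolding \<rho>2(2) by (simp add: field_simps)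
  then show ?thesis unfolding K_def by (simp add: field_simps)
qed

lemma info_ge:
  assumes N: "N \<ge> 640000"
  defines "\<delta> \<equiv> 1 / (10 ^ 6 * exp 64)"
  shows "real N / (10 ^ 8 * exp 64) * (1 - error_rate 0 out / \<delta>) \<le> info"
proof (cases "error_rate 0 out \<le> \<delta>")
  case True
  have "real N / (10 ^ 8 * exp 64) * (1 - error_rate 0 out / \<delta>) \<le>
      real N / (10 ^ 8 * exp 64)"
    using error_rate_nonneg[of 0 out] by (intro mult_left_le) (auto simp: \<delta>_def)
  also have "\<dots> \<le> info" using info_ge_if_error_le[OF N] True unfolding \<delta>_def .
  finally show ?thesis .
next
  case False
  have "\<delta> > 0" by (simp add: \<delta>_def)
  with False have "real N / (10 ^ 8 * exp 64) * (1 - error_rate 0 out / \<delta>) \<le> 0"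
    by (intro mult_nonneg_nonpos) (auto simp: field_simps)
  then show ?thesis using info_nonneg by linarith
qed

end

section \<open>Products of discrete distributions\<close>

abbreviation iid_pmf :: "nat \<Rightarrow> 'a \<Rightarrow> 'a pmf \<Rightarrow> (nat \<Rightarrow> 'a) pmf" where
  "iid_pmf m d p \<equiv> Pi_pmf {..<m} d (\<lambda>_. p)"

lemma Pi_pmf_conv_map_if:
  assumes "finite A"
  shows "Pi_pmf A d p =
    map_pmf (\<lambda>(f, g) x. if P x then f x else g x) (pair_pmf (Pi_pmf A d p) (Pi_pmf A d p))"
proof -
  let ?p = "Pi_pmf A d p"
  have "?p = Pi_pmf ({x \<in> A. P x} \<union> {x \<in> A. \<not> P x}) d p"
    by (rule arg_cong[where f = "\<lambda>A. Pi_pmf A d p"]) auto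
  also have "\<dots> = map_pmf (\<lambda>(f, g) x. if x \<in> {x \<in> A. P x} then f x else g x)
      (pair_pmf (Pi_pmf {x \<in> A. P x} d p) (Pi_pmf {x \<in> A. \<not> P x} d p))"
    using assms by (intro Pi_pmf_union) auto
  also have "\<dots> = map_pmf (\<lambda>(f, g) x. if x \<in> {x \<in> A. P x} then f x else g x)
      (pair_pmf (map_pmf (\<lambda>f x. if x \<in> {x \<in> A. P x} then f x else d) ?p)
         (map_pmf (\<lambda>f x. if x \<in> {x \<in> A. \<not> P x} then f x else d) ?p))"
    using assms by (intro arg_cong2[where f = "\<lambda>p q. map_pmf _ (pair_pmf p q)"] Pi_pmf_subset) auto
  also have "\<dots> = map_pmf (\<lambda>(f, g) x. if P x then f x else g x) (pair_pmf ?p ?p)"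
    unfolding map_pair[symmetric] map_pmf_comp
    by (intro map_pmf_cong refl) (use set_Pi_pmf_subset[OF assms] in \<open>fastforce simp: fun_eq_iff\<close>)
  finally show ?thesis .
qed

lemma Pi_pmf_pair:
  assumes "finite A"
  shows "Pi_pmf A (d, e) (\<lambda>x. pair_pmf (p x) (q x)) =
    map_pmf (\<lambda>(f, g) x. (f x, g x)) (pair_pmf (Pi_pmf A d p) (Pi_pmf A e q))"
proof (rule pmf_eqI)
  fix h :: "'a \<Rightarrow> 'b \<times> 'c"
  let ?F = "\<lambda>(f, g) x. (f x, g x)"
  have inj: "inj (?F :: ('a \<Rightarrow> 'b) \<times> ('a \<Rightarrow> 'c) \<Rightarrow> _)" by (auto simp: inj_def fun_eq_iff)
  have h: "h = ?F (fst \<circ> h, snd \<circ> h)" by (auto simp: fun_eq_iff)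
  have "pmf (map_pmf ?F (pair_pmf (Pi_pmf A d p) (Pi_pmf A e q))) h =
      pmf (pair_pmf (Pi_pmf A d p) (Pi_pmf A e q)) (fst \<circ> h, snd \<circ> h)"
    by (subst h, rule pmf_map_inj'[OF inj])
  also have "\<dots> = pmf (Pi_pmf A (d, e) (\<lambda>x. pair_pmf (p x) (q x))) h"
  proof -
    have "pmf (pair_pmf (p x) (q x)) (h x) = pmf (p x) (fst (h x)) * pmf (q x) (snd (h x))" for x
      by (cases "h x") (simp add: pmf_pair)
    then show ?thesis
      using assms by (auto simp: pmf_pair pmf_Pi prod.distrib prod_eq_iff)
  qed
  finally show "pmf (Pi_pmf A (d, e) (\<lambda>x. pair_pmf (p x) (q x))) h =
    pmf (map_pmf ?F (pair_pmf (Pi_pmf A d p) (Pi_pmf A e q))) h" by simp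
qed

lemma pair_pmf_of_set:
  assumes "finite A" "A \<noteq> {}" "finite B" "B \<noteq> {}"
  shows "pair_pmf (pmf_of_set A) (pmf_of_set B) = pmf_of_set (A \<times> B)"
proof (rule pmf_eqI)
  fix z show "pmf (pair_pmf (pmf_of_set A) (pmf_of_set B)) z = pmf (pmf_of_set (A \<times> B)) z"
    using assms by (cases z) (simp add: pmf_pair indicator_def card_cartesian_product)
qed

lemma prob_pair_pmf_Times:
  "measure_pmf.prob (pair_pmf p q) (A \<times> B) = measure_pmf.prob p A * measure_pmf.prob q B"
  using measure_pmf_prob_product[of "A \<inter> set_pmf p" "B \<inter> set_pmf q" p q]
    measure_Int_set_pmf[of "pair_pmf p q" "A \<times> B"]
  by (simp add: measure_Int_set_pmf Times_Int_Times countable_Int2)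

lemma iid_pmf_bernoulli_half:
  "iid_pmf N False (bernoulli_pmf (1 / 2)) = map_pmf (nth_default False) (pmf_of_set (cube N))"
proof -
  have "bij_betw (nth_default False) (cube N) (PiE_dflt {..<N} False (\<lambda>_. UNIV))"
  proof (rule bij_betw_byWitness[where f' = "\<lambda>f. map f [0..<N]"])
    show "nth_default False ` cube N \<subseteq> PiE_dflt {..<N} False (\<lambda>_. UNIV)"
      by (auto simp: cube_def nth_default_def PiE_dflt_def)
    show "\<forall>f\<in>PiE_dflt {..<N} False (\<lambda>_. UNIV). nth_default False (map f [0..<N]) = f"
      by (auto simp: nth_default_def PiE_dflt_def fun_eq_iff)
  qed (auto simp: cube_def map_nth_default)
  then have "map_pmf (nth_default False) (pmf_of_set (cube N)) =
      pmf_of_set (PiE_dflt {..<N} False (\<lambda>_. UNIV))"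
    by (intro map_pmf_of_set_bij_betw) auto
  then show ?thesis
    unfolding bernoulli_pmf_half_conv_pmf_of_set by (subst Pi_pmf_of_set) auto
qed

section \<open>Information of discrete random variables\<close>

lemma expectation_bind_pmf:
  fixes f :: "'a \<Rightarrow> real"
  assumes bounded: "\<And>x. x \<in> set_pmf (bind_pmf p K) \<Longrightarrow> \<bar>f x\<bar> \<le> B"
  shows "measure_pmf.expectation (bind_pmf p K) f =
    measure_pmf.expectation p (\<lambda>x. measure_pmf.expectation (K x) f)"
proof -
  define g where "g x = (if x \<in> set_pmf (bind_pmf p K) then f x else 0)" for x
  obtain x\<^sub>0 where "x\<^sub>0 \<in> set_pmf (bind_pmf p K)"
    using set_pmf_not_empty[of "bind_pmf p K"] by blast
  then have "B \<ge> 0" using bounded[of x\<^sub>0] by linarith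
  then have g: "\<bar>g x\<bar> \<le> B" for x using bounded by (auto simp: g_def)
  have "measure_pmf.expectation (bind_pmf p K) f = measure_pmf.expectation (bind_pmf p K) g"
    by (intro integral_cong_AE) (auto simp: AE_measure_pmf_iff g_def)
  also have "\<dots> = measure_pmf.expectation p (\<lambda>x. measure_pmf.expectation (K x) g)"
    unfolding measure_pmf_bind using g
    by (intro integral_bind[where K = "count_space UNIV" and B = B and B' = 1])
      (auto simp: measure_pmf.finite_measure_axioms measure_pmf.emeasure_space_1
        measure_pmf_in_subprob_space)
  also have "\<dots> = measure_pmf.expectation p (\<lambda>x. measure_pmf.expectation (K x) f)"
    by (intro integral_cong_AE) (auto simp: AE_measure_pmf_iff g_def intro!: integral_cong_AE)
  finally show ?thesis .
qed

lemma pmf_map_inj_on: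
  assumes "inj_on f A" "set_pmf p \<subseteq> A" "x \<in> A"
  shows "pmf (map_pmf f p) (f x) = pmf p x"
proof (cases "x \<in> set_pmf p")
  case True
  then show ?thesis using assms by (intro pmf_map_inj) (auto intro: inj_on_subset)
next
  case False
  then have "f x \<notin> f ` set_pmf p" using assms by (simp add: inj_on_image_mem_iff)
  then have "pmf (map_pmf f p) (f x) = 0" by (simp add: pmf_eq_0_set_pmf)
  then show ?thesis using False by (simp add: set_pmf_iff)
qed

lemma pmf_bind_map_Pair:
  "pmf (bind_pmf p (\<lambda>a. map_pmf (Pair a) (K a))) (a, b) = pmf p a * pmf (K a) b"
proof -
  have "pmf (map_pmf (Pair a') (K a')) (a, b) = (if a' = a then pmf (K a) b else 0)" for a'
    by (auto simp: inj_def pmf_map_inj' pmf_eq_0_set_pmf)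
  then show ?thesis
    unfolding pmf_bind by (subst integral_measure_pmf_real[where A = "{a}"]) (auto split: if_splits)
qed

lemma pmf_map_bind_map_Pair:
  assumes "inj_on f (set_pmf p \<times> UNIV)" "a \<in> set_pmf p"
  shows "pmf (map_pmf f (bind_pmf p (\<lambda>a. map_pmf (Pair a) (K a)))) (f (a, b)) =
    pmf p a * pmf (K a) b"
  using assms by (subst pmf_map_inj_on) (auto simp: pmf_bind_map_Pair)

lemma map_snd_bind_map_Pair: "map_pmf snd (bind_pmf p (\<lambda>a. map_pmf (Pair a) (K a))) = bind_pmf p K"
  by (simp add: map_bind_pmf pmf.map_comp o_def)

lemma map_fst_bind_map_Pair: "map_pmf fst (bind_pmf p (\<lambda>a. map_pmf (Pair a) (K a))) = p"
  by (simp add: map_bind_pmf pmf.map_comp o_def bind_return_pmf')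

lemma pmf_mult_le_pmf_bind: "pmf p a * pmf (K a) b \<le> pmf (bind_pmf p K) b"
proof -
  let ?J = "bind_pmf p (\<lambda>a. map_pmf (Pair a) (K a))"
  have "pmf p a * pmf (K a) b = measure_pmf.prob ?J {(a, b)}"
    by (simp add: measure_pmf_single pmf_bind_map_Pair)
  also have "\<dots> \<le> measure_pmf.prob ?J (snd -` {b})"
    by (intro measure_pmf.finite_measure_mono) auto
  also have "\<dots> = pmf (bind_pmf p K) b"
    by (simp add: pmf_map flip: map_snd_bind_map_Pair[of p K])
  finally show ?thesis .
qed

definition channel_ratio :: "'a pmf \<Rightarrow> ('a \<Rightarrow> 'b pmf) \<Rightarrow> 'a \<Rightarrow> 'b \<Rightarrow> real" where
  "channel_ratio U K x y = pmf (K x) y / pmf (bind_pmf U K) y"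

lemma pmf_eq_channel_ratio:
  assumes "x \<in> set_pmf U"
  shows "pmf (K x) y = pmf (bind_pmf U K) y * channel_ratio U K x y"
  using assms by (cases "pmf (bind_pmf U K) y = 0") (auto simp: channel_ratio_def pmf_eq_0_set_pmf)

lemma channel_ratio_nonneg: "0 \<le> channel_ratio U K x y"
  by (simp add: channel_ratio_def)

lemma one_le_of_one_le_mult_pmf:
  assumes "1 \<le> B * pmf p x"
  shows "1 \<le> B"
proof -
  have "0 < B" using assms by (smt (verit) mult_nonpos_nonneg pmf_nonneg)
  then have "B * pmf p x \<le> B" by (intro mult_left_le pmf_le_1) simp
  then show ?thesis using assms by linarith
qed

lemma channel_ratio_le:
  assumes "1 \<le> B * pmf U x"
  shows "channel_ratio U K x y \<le> B"
proof -
  have B: "1 \<le> B" using one_le_of_one_le_mult_pmf[OF assms] .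
  have "pmf (K x) y \<le> B * pmf U x * pmf (K x) y"
    using mult_right_mono[OF assms, of "pmf (K x) y"] by simp
  also have "\<dots> \<le> B * pmf (bind_pmf U K) y"
    using mult_left_mono[OF pmf_mult_le_pmf_bind[of U x K y], of B] B by (simp add: mult.assoc)
  finally show ?thesis
    unfolding channel_ratio_def
    using B by (cases "pmf (bind_pmf U K) y = 0") (simp_all add: pos_divide_le_eq less_le)
qed

lemma pair_measure_pmf:
  fixes p :: "'a :: countable pmf" and q :: "'b :: countable pmf"
  shows "measure_pmf p \<Otimes>\<^sub>M measure_pmf q = measure_pmf (pair_pmf p q)"
proof (rule pair_measure_eqI)
  have "sets (measure_pmf p \<Otimes>\<^sub>M measure_pmf q) =
      sets (count_space (UNIV :: 'a set) \<Otimes>\<^sub>M count_space (UNIV :: 'b set))"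
    by (intro sets_pair_measure_cong) auto
  then show "sets (measure_pmf p \<Otimes>\<^sub>M measure_pmf q) = sets (measure_pmf (pair_pmf p q))"
    by (subst (asm) pair_measure_countable) auto
  show "emeasure p A * emeasure q B = emeasure (pair_pmf p q) (A \<times> B)" for A B
    using prob_pair_pmf_Times[of p q A B]
    by (simp add: measure_pmf.emeasure_eq_measure ennreal_mult)
qed (auto intro: prob_space_imp_sigma_finite measure_pmf.prob_space_axioms)

lemma KL_divergence_pmf:
  assumes "1 < b" and f: "\<And>x. 0 \<le> f x" "\<And>x. pmf p x = pmf q x * f x"
  shows "KL_divergence b (measure_pmf q) (measure_pmf p) =
    measure_pmf.expectation q (\<lambda>x. f x * log b (f x))"
proof -
  have "measure_pmf p = density (count_space UNIV) (\<lambda>x. ennreal (pmf q x) * ennreal (f x))"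
    using f by (simp add: measure_pmf_eq_density[of p] ennreal_mult)
  also have "\<dots> = density (measure_pmf q) f"
    by (simp add: measure_pmf_eq_density[of q] density_density_eq)
  finally show ?thesis
    using f assms(1)
    by (simp add: sigma_finite_measure.KL_density prob_space_imp_sigma_finite
        measure_pmf.prob_space_axioms)
qed

lemma mutual_information_pmf:
  fixes X :: "'w \<Rightarrow> 'a :: countable" and Y :: "'w \<Rightarrow> 'b :: countable" and E :: "'w pmf"
  shows "prob_space.mutual_information (measure_pmf E) b (count_space UNIV) (count_space UNIV) X Y =
    KL_divergence b (pair_pmf (map_pmf X E) (map_pmf Y E)) (map_pmf (\<lambda>\<omega>. (X \<omega>, Y \<omega>)) E)"
  by (subst prob_space.mutual_information_def[OF measure_pmf.prob_space_axioms])
    (simp add: pair_measure_countable map_pmf_rep_eq flip: pair_measure_pmf)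

lemma conditional_mutual_information_channel:
  fixes X :: "'w \<Rightarrow> 'a :: countable" and Y :: "'w \<Rightarrow> 'b :: countable" and Z :: "'w \<Rightarrow> 'c :: countable"
  assumes "1 < b"
    and joint: "map_pmf (\<lambda>\<omega>. (X \<omega>, Y \<omega>, Z \<omega>)) E = bind_pmf U (\<lambda>x. map_pmf (Pair x) (K x))"
    and indep: "\<And>x. map_pmf snd (K x) = D"
  shows "prob_space.conditional_mutual_information (measure_pmf E) b
      (count_space UNIV) (count_space UNIV) (count_space UNIV) X Y Z =
    measure_pmf.expectation (pair_pmf U (bind_pmf U K))
      (\<lambda>(x, y). channel_ratio U K x y * log b (channel_ratio U K x y))"
proof -
  let ?J = "map_pmf (\<lambda>\<omega>. (X \<omega>, Y \<omega>, Z \<omega>)) E"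
  have X: "map_pmf X E = U"
    using arg_cong[OF joint, of "map_pmf fst"]
    by (simp add: pmf.map_comp o_def map_fst_bind_map_Pair)
  have YZ: "map_pmf (\<lambda>\<omega>. (Y \<omega>, Z \<omega>)) E = bind_pmf U K"
    using arg_cong[OF joint, of "map_pmf snd"]
    by (simp add: pmf.map_comp o_def map_snd_bind_map_Pair)
  have Z: "map_pmf Z E = D"
    using arg_cong[OF YZ, of "map_pmf snd"] by (simp add: pmf.map_comp o_def map_bind_pmf indep)
  have "map_pmf (\<lambda>\<omega>. (X \<omega>, Z \<omega>)) E = map_pmf (\<lambda>(x, yz). (x, snd yz)) ?J"
    by (simp add: pmf.map_comp o_def)
  also have "\<dots> = bind_pmf U (\<lambda>x. map_pmf (Pair x) (map_pmf snd (K x)))"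
    by (simp add: joint map_bind_pmf pmf.map_comp o_def)
  also have "\<dots> = pair_pmf U D"
    unfolding indep by (simp add: pair_pmf_def map_pmf_def)
  finally have "prob_space.mutual_information (measure_pmf E) b
      (count_space UNIV) (count_space UNIV) X Z = 0"
    by (simp add: mutual_information_pmf X Z sigma_finite_measure.KL_same_eq_0
        prob_space_imp_sigma_finite measure_pmf.prob_space_axioms)
  then have "prob_space.conditional_mutual_information (measure_pmf E) b
      (count_space UNIV) (count_space UNIV) (count_space UNIV) X Y Z =
    KL_divergence b (pair_pmf U (bind_pmf U K)) ?J"
    by (simp add: prob_space.conditional_mutual_information_def[OF measure_pmf.prob_space_axioms]
        pair_measure_countable mutual_information_pmf X YZ)
  also have "\<dots> = measure_pmf.expectation (pair_pmf U (bind_pmf U K))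
      (\<lambda>v. case_prod (channel_ratio U K) v * log b (case_prod (channel_ratio U K) v))"
  proof (rule KL_divergence_pmf[OF assms(1)])
    show "pmf ?J v = pmf (pair_pmf U (bind_pmf U K)) v * case_prod (channel_ratio U K) v" for v
      using pmf_eq_channel_ratio[of "fst v" U K "snd v"]
      by (cases v; cases "fst v \<in> set_pmf U")
        (simp_all add: joint pmf_bind_map_Pair pmf_pair pmf_eq_0_set_pmf)
  qed (simp add: channel_ratio_nonneg split: prod.split)
  finally show ?thesis by (simp add: case_prod_unfold)
qed

lemma abs_mult_log_le:
  fixes q :: real
  assumes "1 < b" "0 \<le> q" "q \<le> B" "1 \<le> B"
  shows "\<bar>q * log b q\<bar> \<le> (B * ln B + 1) / ln b"
proof -
  have "-1 \<le> q * ln q" using mult_ln_ge[of "q - 1"] assms by simp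
  moreover have "q * ln q \<le> B * ln B"
  proof (cases "q \<ge> 1")
    case True
    then show ?thesis using assms by (intro mult_mono) auto
  next
    case False
    then have "q * ln q \<le> 0" using assms by (cases "q = 0") (auto intro: mult_nonneg_nonpos)
    also have "0 \<le> B * ln B" using assms by simp
    finally show ?thesis .
  qed
  moreover have "0 \<le> B * ln B" using assms by simp
  ultimately have "\<bar>q * ln q\<bar> / ln b \<le> (B * ln B + 1) / ln b"
    using assms(1) by (intro divide_right_mono) (auto simp: abs_le_iff)
  then show ?thesis using assms(1) by (simp add: log_def abs_mult)
qed

lemma expectation_channel_ratio:
  assumes "finite (set_pmf U)" "finite T" "\<And>x. set_pmf (K x) \<subseteq> T"
  shows "measure_pmf.expectation (pair_pmf U (bind_pmf U K))
      (\<lambda>(x, t). channel_ratio U K x t * f x t) =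
    measure_pmf.expectation U (\<lambda>x. \<Sum>t\<in>T. pmf (K x) t * f x t)"
proof -
  have "measure_pmf.expectation (pair_pmf U (bind_pmf U K))
      (\<lambda>(x, t). channel_ratio U K x t * f x t) =
      (\<Sum>(x, t)\<in>set_pmf U \<times> T.
        channel_ratio U K x t * f x t * pmf (pair_pmf U (bind_pmf U K)) (x, t))"
    using assms
    by (subst integral_measure_pmf_real[where A = "set_pmf U \<times> T"]) (auto simp: split_def)
  also have "\<dots> = (\<Sum>(x, t)\<in>set_pmf U \<times> T. pmf (K x) t * f x t * pmf U x)"
    by (intro sum.cong) (auto simp: pmf_pair pmf_eq_channel_ratio[where U = U])
  also have "\<dots> = (\<Sum>x\<in>set_pmf U. (\<Sum>t\<in>T. pmf (K x) t * f x t) * pmf U x)"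
    by (simp add: sum_distrib_right flip: sum.cartesian_product)
  also have "\<dots> = measure_pmf.expectation U (\<lambda>x. \<Sum>t\<in>T. pmf (K x) t * f x t)"
    using assms(1) by (intro integral_measure_pmf_real[symmetric]) auto
  finally show ?thesis .
qed

lemma conditional_mutual_information_context:
  fixes X :: "'w \<Rightarrow> 'a :: countable" and Y :: "'w \<Rightarrow> 's :: countable \<times> 't :: countable"
    and Z :: "'w \<Rightarrow> 'z :: countable" and s :: "'c \<Rightarrow> 's" and z :: "'c \<Rightarrow> 'z"
  assumes "1 < b"
    and joint: "map_pmf (\<lambda>\<omega>. (X \<omega>, Y \<omega>, Z \<omega>)) E =
      do { c \<leftarrow> C; x \<leftarrow> U; t \<leftarrow> K c x; return_pmf (x, (s c, t), z c) }"
    and inj: "inj_on (\<lambda>c. (s c, z c)) (set_pmf C)"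
    and U: "\<And>x. x \<in> set_pmf U \<Longrightarrow> 1 \<le> B * pmf U x"
  shows "prob_space.conditional_mutual_information (measure_pmf E) b
      (count_space UNIV) (count_space UNIV) (count_space UNIV) X Y Z =
    measure_pmf.expectation C (\<lambda>c. measure_pmf.expectation (pair_pmf U (bind_pmf U (K c)))
      (\<lambda>(x, t). channel_ratio U (K c) x t * log b (channel_ratio U (K c) x t)))"
proof -
  define g where "g = (\<lambda>(c, t). ((s c, t :: 't), z c))"
  define L where "L x = map_pmf g (bind_pmf C (\<lambda>c. map_pmf (Pair c) (K c x)))" for x
  let ?f = "\<lambda>(x, y). channel_ratio U L x y * log b (channel_ratio U L x y)"
  let ?V = "\<lambda>c. pair_pmf U (bind_pmf U (K c))"
  have bind_L: "bind_pmf U L = map_pmf g (bind_pmf C (\<lambda>c. map_pmf (Pair c) (bind_pmf U (K c))))"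
    unfolding L_def map_bind_pmf by (subst bind_commute_pmf) (rule refl)
  have inj_g: "inj_on g (set_pmf C \<times> UNIV)" using inj by (auto simp: g_def inj_on_def)
  have ratio: "channel_ratio U L x (g (c, t)) = channel_ratio U (K c) x t"
    if "c \<in> set_pmf C" for c x t
    unfolding channel_ratio_def bind_L
    using that by (simp add: L_def pmf_map_bind_map_Pair[OF inj_g that] set_pmf_iff)
  have bounded: "\<bar>?f v\<bar> \<le> (B * ln B + 1) / ln b" if "fst v \<in> set_pmf U" for v
    using U[OF that] one_le_of_one_le_mult_pmf[of B U "fst v"]
    by (auto simp: case_prod_unfold
        intro!: abs_mult_log_le assms(1) channel_ratio_nonneg channel_ratio_le)
  have "prob_space.conditional_mutual_information (measure_pmf E) b
      (count_space UNIV) (count_space UNIV) (count_space UNIV) X Y Z =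
    measure_pmf.expectation (pair_pmf U (bind_pmf U L)) ?f"
  proof (rule conditional_mutual_information_channel[OF assms(1), where D = "map_pmf z C"])
    show "map_pmf (\<lambda>\<omega>. (X \<omega>, Y \<omega>, Z \<omega>)) E = bind_pmf U (\<lambda>x. map_pmf (Pair x) (L x))"
      unfolding joint L_def g_def
      by (subst bind_commute_pmf) (simp add: map_pmf_def bind_assoc_pmf bind_return_pmf)
    show "map_pmf snd (L x) = map_pmf z C" for x
      by (simp add: L_def g_def map_pmf_def bind_assoc_pmf bind_return_pmf)
  qed
  also have "pair_pmf U (bind_pmf U L) = bind_pmf C (\<lambda>c. map_pmf (\<lambda>(x, t). (x, g (c, t))) (?V c))"
    unfolding bind_L
    by (simp add: pair_pmf_def map_pmf_def bind_assoc_pmf bind_return_pmf bind_commute_pmf[of C U])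
  also have "measure_pmf.expectation \<dots> ?f =
      measure_pmf.expectation C (\<lambda>c.
        measure_pmf.expectation (map_pmf (\<lambda>(x, t). (x, g (c, t))) (?V c)) ?f)"
    by (rule expectation_bind_pmf, rule bounded) auto
  also have "\<dots> = measure_pmf.expectation C (\<lambda>c. measure_pmf.expectation (?V c)
      (\<lambda>(x, t). channel_ratio U (K c) x t * log b (channel_ratio U (K c) x t)))"
    by (intro integral_cong_AE) (auto simp: AE_measure_pmf_iff case_prod_unfold ratio)
  finally show ?thesis .
qed

section \<open>Evaluation of k-XOR and k-BTX\<close>

definition join_halves :: "nat \<Rightarrow> (nat \<Rightarrow> 'a) \<Rightarrow> (nat \<Rightarrow> 'a) \<Rightarrow> nat \<Rightarrow> 'a" where
  "join_halves k f g = (\<lambda>i. if i < k div 2 then f i else g i)"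

definition half_bits ::
    "(nat \<Rightarrow> nat) \<Rightarrow> nat \<Rightarrow> bool \<Rightarrow> (nat \<Rightarrow> bool) \<Rightarrow> nat \<Rightarrow> nat \<Rightarrow> bool" where
  "half_bits d m x u = (\<lambda>i l. if l = m then x else i = d l \<and> u l)"

lemma kXOR_half_bits:
  assumes k: "4 \<le> k" "even k" and m: "m < n"
  shows "kXOR k n (join_halves k (half_bits d m x u) (half_bits d m y v)) \<longleftrightarrow> x \<noteq> y"
proof -
  let ?B = "join_halves k (half_bits d m x u) (half_bits d m y v)"
  let ?S = "\<lambda>l. {i. i < k \<and> ?B i l}"
  have "card (?S l) \<noteq> k div 2" if "l \<noteq> m" for l
  proof -
    have "card (?S l) \<le> card {d l}"
      using that
      by (intro card_mono) (auto simp: join_halves_def half_bits_def split: if_splits)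
    then show ?thesis using k by auto
  qed
  then have "kXOR k n ?B \<longleftrightarrow> card (?S m) = k div 2"
    unfolding kXOR_def using m by metis
  also have "?S m = (if x then {..<k div 2} else {}) \<union> (if y then {k div 2..<k} else {})"
    by (auto simp: join_halves_def half_bits_def)
  also have "card \<dots> = k div 2 \<longleftrightarrow> x \<noteq> y"
  proof -
    have "{..<k div 2} \<union> {k div 2..<k} = {..<k}" by auto
    then show ?thesis
      using k(1) even_two_times_div_two[OF k(2)] by (cases x; cases y) auto
  qed
  finally show ?thesis .
qed

lemma corr_eq_sum:
  assumes "length x = N" "length y = N"
  shows "corr x y = real N - 2 * (\<Sum>j<N. of_bool (x ! j \<noteq> y ! j))"
proof -
  have "corr x y = (\<Sum>j<N. spin (x ! j) * spin (y ! j))"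
    using assms by (simp add: corr_def sum_list_sum_nth atLeast0LessThan)
  also have "\<dots> = (\<Sum>j<N. 1 - 2 * of_bool (x ! j \<noteq> y ! j))"
    by (intro sum.cong refl) (auto simp: spin_def)
  finally show ?thesis by (simp add: sum_subtractf sum_distrib_left)
qed

lemma kBTX_eq_Some_iff:
  assumes xy: "x \<in> cube N" "y \<in> cube N" and \<epsilon>: "0 < \<epsilon>" "real N = 1 / \<epsilon>\<^sup>2"
    and kXOR: "\<And>j. j < N \<Longrightarrow> kXOR k n (\<lambda>i. B i j) \<longleftrightarrow> x ! j \<noteq> y ! j"
  shows "kBTX \<epsilon> k n N B = Some v \<longleftrightarrow> gap_answer N v x y"
proof -
  have "(\<Sum>j<N. of_bool (kXOR k n (\<lambda>i. B i j))) = (\<Sum>j<N. of_bool (x ! j \<noteq> y ! j) :: real)"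
    using kXOR by (intro sum.cong) auto
  also have "\<dots> = (real N - corr x y) / 2"
    using corr_eq_sum[of x N y] xy by (simp add: cube_def)
  finally have sum: "(\<Sum>j<N. of_bool (kXOR k n (\<lambda>i. B i j))) = (real N - corr x y) / 2" .
  have dev: "\<bar>(real N - corr x y) / 2 - 1 / (2 * \<epsilon>\<^sup>2)\<bar> = \<bar>corr x y\<bar> / 2"
    using \<epsilon>(2) by (simp add: field_simps)
  define c where "c = sqrt (real N)"
  have c: "1 / \<epsilon> = c" "2 / \<epsilon> = 2 * c" "c > 0"
    using \<epsilon> by (simp_all add: c_def real_sqrt_divide)
  show ?thesis
    unfolding kBTX_def Let_def sum dev c(1,2) gap_answer_def c_def[symmetric] using c(3) by auto
qed

section \<open>Transcripts of protocol trees\<close>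

text \<open>The sites in \<open>S\<close> write the bits of \<open>t\<close>, provided that the other sites do so.\<close>

primrec consistent :: "nat set \<Rightarrow> ptree \<Rightarrow> bool list \<Rightarrow> inputs \<Rightarrow> (nat \<Rightarrow> nat) \<Rightarrow> bool" where
  "consistent S (Output v) t B r \<longleftrightarrow> t = []"
| "consistent S (Speak i f t\<^sub>0 t\<^sub>1) t B r \<longleftrightarrow> (case t of [] \<Rightarrow> False | c # t' \<Rightarrow>
     (i \<in> S \<longrightarrow> f (B i) (r i) = c) \<and> (if c then consistent S t\<^sub>1 t' B r else consistent S t\<^sub>0 t' B r))"

lemma board_eq_iff: "board T B r = t \<longleftrightarrow> consistent S T t B r \<and> consistent (- S) T t B r"
  by (induction T arbitrary: t) (auto split: list.splits)

lemma consistent_cong: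
  assumes "\<And>i. i \<in> S \<Longrightarrow> B i = B' i" "\<And>i. i \<in> S \<Longrightarrow> r i = r' i"
  shows "consistent S T t B r \<longleftrightarrow> consistent S T t B' r'"
  using assms by (induction T arbitrary: t) (auto split: list.splits)

primrec paths :: "ptree \<Rightarrow> bool list set" where
  "paths (Output v) = {[]}"
| "paths (Speak i f t\<^sub>0 t\<^sub>1) = (#) False ` paths t\<^sub>0 \<union> (#) True ` paths t\<^sub>1"

lemma finite_paths: "finite (paths T)"
  by (induction T) auto

lemma board_in_paths: "board T B r \<in> paths T"
  by (induction T) auto

primrec verdict :: "ptree \<Rightarrow> bool list \<Rightarrow> bool" where
  "verdict (Output v) t = v"
| "verdict (Speak i f t\<^sub>0 t\<^sub>1) t =
     (case t of [] \<Rightarrow> False | c # t' \<Rightarrow> if c then verdict t\<^sub>1 t' else verdict t\<^sub>0 t')"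

lemma answer_eq_verdict: "answer T B r = verdict T (board T B r)"
  by (induction T) auto

section \<open>The input distribution\<close>

definition dir_dist :: "nat \<Rightarrow> nat \<Rightarrow> (nat \<Rightarrow> nat) pmf" where
  "dir_dist k n = iid_pmf n 0 (pmf_of_set {..<k})"

definition noise_dist :: "nat \<Rightarrow> (nat \<Rightarrow> bool) pmf" where
  "noise_dist n = iid_pmf n False (bernoulli_pmf (1 / 2))"

fun block_of ::
    "nat \<Rightarrow> (nat \<Rightarrow> nat) \<times> nat \<times> (bool \<times> bool) \<times> (nat \<Rightarrow> bool) \<times> (nat \<Rightarrow> bool) \<Rightarrow> block" where
  "block_of k (d, m, (x, y), (u, v)) =
     \<lparr> Dir = d, Special = m, Bits = join_halves k (half_bits d m x u) (half_bits d m y v) \<rparr>"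

text \<open>
  Drawing the noise of the two halves of the sites from separate copies does not change the law, as
  only one site reads the noise of a given coordinate, but makes the halves independent.
\<close>

lemma block_dist_eq:
  "block_dist k n = map_pmf (block_of k)
     (pair_pmf (dir_dist k n) (pair_pmf (pmf_of_set {..<n})
       (pair_pmf (pair_pmf (bernoulli_pmf (1 / 2)) (bernoulli_pmf (1 / 2)))
         (pair_pmf (noise_dist n) (noise_dist n)))))"
proof -
  let ?bit = "bernoulli_pmf (1 / 2)"
  have split: "(\<lambda>i l. if l = m then (if i < k div 2 then x else y)
        else i = d l \<and> (if d l < k div 2 then u l else v l)) =
      join_halves k (half_bits d m x u) (half_bits d m y v)" for d m x y u v
    by (auto simp: join_halves_def half_bits_def fun_eq_iff)
  have "block_dist k n = do {
      d \<leftarrow> dir_dist k n;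
      u \<leftarrow> map_pmf (\<lambda>(u, v) l. if d l < k div 2 then u l else v l)
        (pair_pmf (noise_dist n) (noise_dist n));
      m \<leftarrow> pmf_of_set {..<n}; x \<leftarrow> ?bit; y \<leftarrow> ?bit;
      return_pmf \<lparr> Dir = d, Special = m,
        Bits = (\<lambda>i l. if l = m then (if i < k div 2 then x else y) else i = d l \<and> u l) \<rparr> }"
    unfolding block_dist_def dir_dist_def noise_dist_def
    by (subst Pi_pmf_conv_map_if[symmetric]) auto
  also have "\<dots> = do {
      d \<leftarrow> dir_dist k n; u \<leftarrow> noise_dist n; v \<leftarrow> noise_dist n;
      m \<leftarrow> pmf_of_set {..<n}; x \<leftarrow> ?bit; y \<leftarrow> ?bit;
      return_pmf (block_of k (d, m, (x, y), (u, v))) }"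
    by (simp add: map_pmf_def pair_pmf_def bind_assoc_pmf bind_return_pmf split)
  also have "\<dots> = do {
      d \<leftarrow> dir_dist k n; m \<leftarrow> pmf_of_set {..<n}; x \<leftarrow> ?bit; y \<leftarrow> ?bit;
      u \<leftarrow> noise_dist n; v \<leftarrow> noise_dist n;
      return_pmf (block_of k (d, m, (x, y), (u, v))) }"
    by (simp only: bind_commute_pmf[of "noise_dist n" "pmf_of_set {..<n}"]
        bind_commute_pmf[of "noise_dist n" ?bit])
  finally show ?thesis
    by (simp add: map_pmf_def pair_pmf_def bind_assoc_pmf bind_return_pmf del: block_of.simps)
qed

lemma nu_eq:
  "nu k n N = map_pmf (\<lambda>(d, m, (x, y), (u, v)) j. block_of k (d j, m j, (x j, y j), (u j, v j)))
     (pair_pmf (iid_pmf N (\<lambda>_. 0) (dir_dist k n)) (pair_pmf (iid_pmf N 0 (pmf_of_set {..<n}))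
       (pair_pmf
         (pair_pmf (iid_pmf N False (bernoulli_pmf (1 / 2)))
           (iid_pmf N False (bernoulli_pmf (1 / 2))))
         (pair_pmf (iid_pmf N (\<lambda>_. False) (noise_dist n)) (iid_pmf N (\<lambda>_. False) (noise_dist n))))))"
proof -
  have "nu k n N = map_pmf ((\<circ>) (block_of k))
      (iid_pmf N (\<lambda>_. 0, 0, (False, False), (\<lambda>_. False, \<lambda>_. False))
        (pair_pmf (dir_dist k n) (pair_pmf (pmf_of_set {..<n})
          (pair_pmf (pair_pmf (bernoulli_pmf (1 / 2)) (bernoulli_pmf (1 / 2)))
            (pair_pmf (noise_dist n) (noise_dist n))))))"
    unfolding nu_def block_dist_eq
    by (rule Pi_pmf_map) (auto simp: join_halves_def half_bits_def fun_eq_iff)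
  then show ?thesis
    unfolding Pi_pmf_pair[OF finite_lessThan]
    by (simp add: map_pmf_def pair_pmf_def bind_assoc_pmf bind_return_pmf o_def
        del: block_of.simps)
qed

text \<open>
  A context consists of \<open>D\<close>, \<open>M\<close> and the public coins; the secret of a half consists of the noise and the
  private coins of its sites.
\<close>

type_synonym public_context = "(nat \<Rightarrow> nat \<Rightarrow> nat) \<times> (nat \<Rightarrow> nat) \<times> nat"
type_synonym half_secret = "(nat \<Rightarrow> nat \<Rightarrow> bool) \<times> (nat \<Rightarrow> nat)"
type_synonym sign_vectors = "bool list \<times> bool list"

definition public_coins :: "public_context \<Rightarrow> nat" where
  "public_coins c = snd (snd c)"

fun half_input :: "public_context \<Rightarrow> bool list \<Rightarrow> (nat \<Rightarrow> nat \<Rightarrow> bool) \<Rightarrow> inputs" where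
  "half_input (d, m, s) x u = (\<lambda>i j. half_bits (d j) (m j) (nth_default False x j) (u j) i)"

context
  fixes k n N :: nat and P :: protocol
begin

definition context_dist :: "public_context pmf" where
  "context_dist = pair_pmf (iid_pmf N (\<lambda>_. 0) (dir_dist k n))
     (pair_pmf (iid_pmf N 0 (pmf_of_set {..<n})) (Public P))"

definition secret_dist :: "half_secret pmf" where
  "secret_dist = pair_pmf (iid_pmf N (\<lambda>_. False) (noise_dist n)) (Pi_pmf {..<k} 0 (Private P))"

fun joint_input :: "public_context \<Rightarrow> sign_vectors \<Rightarrow> half_secret \<times> half_secret \<Rightarrow> inputs" where
  "joint_input c (x, y) ((u, _), (v, _)) = join_halves k (half_input c x u) (half_input c y v)"

fun joint_coins :: "half_secret \<times> half_secret \<Rightarrow> nat \<Rightarrow> nat" where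
  "joint_coins ((_, r), (_, r')) = join_halves k r r'"

fun outcome_of :: "public_context \<times> sign_vectors \<times> half_secret \<times> half_secret \<Rightarrow> outcome" where
  "outcome_of ((d, m, s), xy, \<sigma>) =
     (\<lambda>j. \<lparr> Dir = d j, Special = m j, Bits = (\<lambda>i. joint_input (d, m, s) xy \<sigma> i j) \<rparr>,
      s, joint_coins \<sigma>)"

abbreviation uniform_signs :: "sign_vectors pmf" where
  "uniform_signs \<equiv> pmf_of_set (cube N \<times> cube N)"

lemma execution_eq:
  "execution k n N P = map_pmf outcome_of
     (pair_pmf context_dist (pair_pmf uniform_signs (pair_pmf secret_dist secret_dist)))"
proof -
  let ?dirs = "iid_pmf N (\<lambda>_. 0) (dir_dist k n)" and ?specials = "iid_pmf N 0 (pmf_of_set {..<n})"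
    and ?noise = "iid_pmf N (\<lambda>_. False) (noise_dist n)" and ?coins = "Pi_pmf {..<k} 0 (Private P)"
    and ?U = "pmf_of_set (cube N)"
  have coins: "?coins = map_pmf (\<lambda>(r, r'). join_halves k r r') (pair_pmf ?coins ?coins)"
    unfolding join_halves_def by (rule Pi_pmf_conv_map_if) simp
  have signs: "pair_pmf ?U ?U = uniform_signs"
    by (rule pair_pmf_of_set) auto
  have outcome: "outcome_of ((d, m, s), (x, y), (u, r), (v, r')) =
      (\<lambda>j. block_of k (d j, m j, (nth_default False x j, nth_default False y j), (u j, v j)),
       s, join_halves k r r')" for d m s x y u v r r'
    by (auto simp: join_halves_def fun_eq_iff)
  have "execution k n N P = do {
      d \<leftarrow> ?dirs; m \<leftarrow> ?specials; x \<leftarrow> ?U; y \<leftarrow> ?U; u \<leftarrow> ?noise; v \<leftarrow> ?noise;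
      s \<leftarrow> Public P; r \<leftarrow> ?coins; r' \<leftarrow> ?coins;
      return_pmf (outcome_of ((d, m, s), (x, y), (u, r), (v, r'))) }"
    unfolding execution_def nu_eq iid_pmf_bernoulli_half
    by (subst coins) (simp add: map_pmf_def pair_pmf_def bind_assoc_pmf bind_return_pmf outcome
        del: block_of.simps outcome_of.simps)
  also have "\<dots> = do {
      d \<leftarrow> ?dirs; m \<leftarrow> ?specials; s \<leftarrow> Public P; x \<leftarrow> ?U; y \<leftarrow> ?U;
      u \<leftarrow> ?noise; r \<leftarrow> ?coins; v \<leftarrow> ?noise; r' \<leftarrow> ?coins;
      return_pmf (outcome_of ((d, m, s), (x, y), (u, r), (v, r'))) }"
    by (simp only: bind_commute_pmf[of ?noise "Public P"] bind_commute_pmf[of ?U "Public P"]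
        bind_commute_pmf[of ?noise ?coins])
  finally show ?thesis
    unfolding signs[symmetric] context_dist_def secret_dist_def
    by (simp add: map_pmf_def pair_pmf_def bind_assoc_pmf bind_return_pmf del: outcome_of.simps)
qed

section \<open>Factorization of the transcript probabilities\<close>

definition context_tree :: "public_context \<Rightarrow> ptree" where
  "context_tree c = Tree P (public_coins c)"

definition joint_board ::
    "public_context \<Rightarrow> sign_vectors \<Rightarrow> half_secret \<times> half_secret \<Rightarrow> bool list" where
  "joint_board c xy \<sigma> = board (context_tree c) (joint_input c xy \<sigma>) (joint_coins \<sigma>)"

definition board_dist :: "public_context \<Rightarrow> sign_vectors \<Rightarrow> bool list pmf" where
  "board_dist c xy = map_pmf (joint_board c xy) (pair_pmf secret_dist secret_dist)"

definition message_prob :: "nat set \<Rightarrow> public_context \<Rightarrow> bool list \<Rightarrow> bool list \<Rightarrow> real" where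
  "message_prob S c t x =
     measure_pmf.prob secret_dist {(u, r). consistent S (context_tree c) t (half_input c x u) r}"

abbreviation "first_half_prob \<equiv> message_prob {..<k div 2}"
abbreviation "second_half_prob \<equiv> message_prob {k div 2..}"

lemma joint_board_eq_iff:
  "joint_board c (x, y) ((u, r), (v, r')) = t \<longleftrightarrow>
     consistent {..<k div 2} (context_tree c) t (half_input c x u) r \<and>
     consistent {k div 2..} (context_tree c) t (half_input c y v) r'"
  unfolding joint_board_def board_eq_iff[where S = "{..<k div 2}"] Compl_lessThan
  by (intro arg_cong2[where f = "(\<and>)"] consistent_cong) (simp_all add: join_halves_def)

lemma pmf_board_dist: "pmf (board_dist c (x, y)) t = first_half_prob c t x * second_half_prob c t y"
proof -
  have "joint_board c (x, y) -` {t} =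
      {(u, r). consistent {..<k div 2} (context_tree c) t (half_input c x u) r} \<times>
      {(v, r'). consistent {k div 2..} (context_tree c) t (half_input c y v) r'}"
    by (simp add: set_eq_iff split_paired_all joint_board_eq_iff)
  then show ?thesis
    by (simp add: board_dist_def message_prob_def pmf_map prob_pair_pmf_Times)
qed

lemma set_board_dist: "set_pmf (board_dist c xy) \<subseteq> paths (context_tree c)"
  by (auto simp: board_dist_def joint_board_def board_in_paths)

lemma two_party_context:
  "two_party (paths (context_tree c)) (first_half_prob c) (second_half_prob c) N"
proof
  show "(\<Sum>t\<in>paths (context_tree c). first_half_prob c t x * second_half_prob c t y) = 1" for x y
    unfolding pmf_board_dist[symmetric] by (intro sum_pmf_eq_1 finite_paths set_board_dist)
qed (simp_all add: finite_paths message_prob_def)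

section \<open>The joint law of the inputs and the transcript\<close>

definition observation ::
    "outcome \<Rightarrow> sign_vectors \<times> (nat \<times> bool list) \<times> nat list \<times> nat list list" where
  "observation \<omega> =
     ((Xvar k N (fst \<omega>), Yvar k N (fst \<omega>)), transcript P \<omega>, (Mvar N (fst \<omega>), Dvar n N (fst \<omega>)))"

fun context_label :: "public_context \<Rightarrow> nat list \<times> nat list list" where
  "context_label (d, m, s) = (map m [0..<N], map (\<lambda>j. map (d j) [0..<n]) [0..<N])"

lemma inj_on_context_label: "inj_on (\<lambda>c. (public_coins c, context_label c)) (set_pmf context_dist)"
proof (rule inj_onI)
  fix c c' :: public_context
  assume c: "c \<in> set_pmf context_dist" and c': "c' \<in> set_pmf context_dist"
    and eq: "(public_coins c, context_label c) = (public_coins c', context_label c')"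
  obtain d m s d' m' s' where [simp]: "c = (d, m, s)" "c' = (d', m', s')" by (cases c; cases c')
  have outside: "d j l = 0" if "(d, m, s) \<in> set_pmf context_dist" "\<not> (j < N \<and> l < n)" for d m s j l
    using that set_Pi_pmf_subset[of "{..<n}" "0::nat" "\<lambda>_. pmf_of_set {..<k}"]
    by (cases "j < N") (auto simp: context_dist_def dir_dist_def set_Pi_pmf PiE_dflt_def subset_iff)
  have "d j l = d' j l" for j l
    using eq outside[of d m s j l] outside[of d' m' s' j l] c c'
    by (cases "j < N \<and> l < n") auto
  moreover have "m j = m' j" for j
    using eq c c' by (cases "j < N") (auto simp: context_dist_def set_Pi_pmf PiE_dflt_def)
  ultimately show "c = c'"
    using eq by (auto simp: public_coins_def fun_eq_iff)
qed

lemma observation_outcome_of: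
  assumes "4 \<le> k" "xy \<in> cube N \<times> cube N"
  shows "observation (outcome_of (c, xy, \<sigma>)) =
    (xy, (public_coins c, joint_board c xy \<sigma>), context_label c)"
proof -
  obtain d m s x y u r v r' where [simp]: "c = (d, m, s)" "xy = (x, y)" "\<sigma> = ((u, r), (v, r'))"
    by (metis prod.exhaust)
  have len: "length x = N" "length y = N" using assms(2) by (auto simp: cube_def)
  have halves_nonempty: "\<exists>i<k div 2. True" "\<exists>i\<ge>k div 2. i < k"
    using assms(1) by (auto intro: exI[of _ 0] exI[of _ "k div 2"])
  define w where "w = fst (outcome_of (c, xy, \<sigma>))"
  have "Xvar k N w = x" "Yvar k N w = y"
    using len halves_nonempty unfolding w_def Xvar_def Yvar_def
    by (auto simp: join_halves_def half_bits_def nth_default_def intro!: nth_equalityI)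
  moreover have "(Mvar N w, Dvar n N w) = context_label c"
    by (simp add: w_def Mvar_def Dvar_def)
  moreover have "inputs_of w = joint_input c xy \<sigma>"
    by (simp add: w_def inputs_of_def fun_eq_iff)
  ultimately show ?thesis
    by (simp add: observation_def transcript_def w_def public_coins_def joint_board_def
        context_tree_def del: joint_input.simps)
qed

lemma observation_law:
  assumes "4 \<le> k"
  shows "map_pmf observation (execution k n N P) = do {
    c \<leftarrow> context_dist;
    xy \<leftarrow> uniform_signs;
    t \<leftarrow> board_dist c xy;
    return_pmf (xy, (public_coins c, t), context_label c) }"
proof -
  have "map_pmf observation (execution k n N P) =
    map_pmf (\<lambda>(c, xy, \<sigma>). (xy, (public_coins c, joint_board c xy \<sigma>), context_label c))
      (pair_pmf context_dist (pair_pmf uniform_signs (pair_pmf secret_dist secret_dist)))"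
    unfolding execution_eq map_pmf_comp
    using assms by (intro map_pmf_cong refl) (auto simp: observation_outcome_of
        simp del: outcome_of.simps context_label.simps)
  then show ?thesis
    by (simp add: board_dist_def pair_pmf_def map_pmf_def bind_assoc_pmf bind_return_pmf)
qed

lemma kBTX_joint_input:
  assumes k: "4 \<le> k" "even k" and m: "\<And>j. j < N \<Longrightarrow> fst (snd c) j < n"
    and xy: "x \<in> cube N" "y \<in> cube N" and \<epsilon>: "0 < \<epsilon>" "real N = 1 / \<epsilon>\<^sup>2"
  shows "kBTX \<epsilon> k n N (joint_input c (x, y) \<sigma>) = Some v \<longleftrightarrow> gap_answer N v x y"
proof (rule kBTX_eq_Some_iff[OF xy \<epsilon>])
  fix j assume "j < N"
  obtain d m s u r u' r' where [simp]: "c = (d, m, s)" "\<sigma> = ((u, r), (u', r'))"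
    by (metis prod.exhaust)
  have "(\<lambda>i. joint_input c (x, y) \<sigma> i j) =
      join_halves k (half_bits (d j) (m j) (nth_default False x j) (u j))
        (half_bits (d j) (m j) (nth_default False y j) (u' j))"
    by (simp add: join_halves_def fun_eq_iff)
  then show "kXOR k n (\<lambda>i. joint_input c (x, y) \<sigma> i j) \<longleftrightarrow> x ! j \<noteq> y ! j"
    using kXOR_half_bits[OF k m[OF \<open>j < N\<close>]] xy \<open>j < N\<close> by (simp add: cube_def nth_default_nth)
qed

fun erroneous :: "sign_vectors \<times> (nat \<times> bool list) \<times> 'z \<Rightarrow> bool" where
  "erroneous ((x, y), (s, t), z) \<longleftrightarrow> gap_answer N (\<not> verdict (Tree P s) t) x y"

lemma error_prob_eq_observation:
  assumes k: "4 \<le> k" "even k" and n: "1 \<le> n" and \<epsilon>: "0 < \<epsilon>" "real N = 1 / \<epsilon>\<^sup>2"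
  shows "error_prob \<epsilon> k n N P =
    measure_pmf.prob (map_pmf observation (execution k n N P)) {e. erroneous e}"
proof -
  let ?wrong = "\<lambda>(w, s, r). kBTX \<epsilon> k n N (inputs_of w) = Some (\<not> answer (Tree P s) (inputs_of w) r)"
  have "?wrong \<omega> \<longleftrightarrow> erroneous (observation \<omega>)" if "\<omega> \<in> set_pmf (execution k n N P)" for \<omega>
  proof -
    from that obtain c x y \<sigma> where c: "c \<in> set_pmf context_dist"
      and xy: "x \<in> cube N" "y \<in> cube N" and \<omega>: "\<omega> = outcome_of (c, (x, y), \<sigma>)"
      unfolding execution_eq by auto
    have m: "fst (snd c) j < n" if "j < N" for j
      using c that n by (auto simp: context_dist_def set_Pi_pmf PiE_dflt_def lessThan_empty_iff)
    obtain w s r where w: "\<omega> = (w, s, r)" by (cases \<omega>)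
    then have "inputs_of w = joint_input c (x, y) \<sigma>" "s = public_coins c" "r = joint_coins \<sigma>"
      using \<omega> by (cases c;
        simp add: inputs_of_def fun_eq_iff public_coins_def del: joint_input.simps)+
    then have "?wrong \<omega> \<longleftrightarrow> gap_answer N (\<not> verdict (context_tree c) (joint_board c (x, y) \<sigma>)) x y"
      using kBTX_joint_input[OF k m xy \<epsilon>]
      by (simp add: w answer_eq_verdict joint_board_def context_tree_def)
    then show ?thesis
      using xy k(1) by (simp add: \<omega> observation_outcome_of context_tree_def)
  qed
  then have "error_prob \<epsilon> k n N P =
      measure_pmf.prob (execution k n N P) (observation -` {e. erroneous e})"
    unfolding error_prob_def
    by (intro measure_pmf.finite_measure_eq_AE) (auto simp: AE_measure_pmf_iff)
  then show ?thesis by simp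
qed

section \<open>Lower bound for protocols\<close>

abbreviation context_info :: "public_context \<Rightarrow> real" where
  "context_info c \<equiv>
     two_party.info (paths (context_tree c)) (first_half_prob c) (second_half_prob c) N"

abbreviation context_error :: "public_context \<Rightarrow> real" where
  "context_error c \<equiv>
     two_party.error_rate (paths (context_tree c)) (first_half_prob c) (second_half_prob c) N
       0 (verdict (context_tree c))"

lemma expectation_uniform_signs:
  "measure_pmf.expectation uniform_signs (\<lambda>(x, y). f x y) = tilt_mean 0 N f"
  by (simp add: integral_pmf_of_set tilt_mean_def cube_mean_def card_cube sum_divide_distrib
      sum.cartesian_product case_prod_unfold)

lemma expectation_log_channel_ratio:
  fixes U :: "sign_vectors pmf"
  defines "U \<equiv> uniform_signs"
  shows "measure_pmf.expectation (pair_pmf U (bind_pmf U (board_dist c)))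
      (\<lambda>(xy, t). channel_ratio U (board_dist c) xy t * log 2 (channel_ratio U (board_dist c) xy t)) =
    context_info c / ln 2"
proof -
  interpret two_party "paths (context_tree c)" "first_half_prob c" "second_half_prob c" N
    by (rule two_party_context)
  have "pmf (bind_pmf U (board_dist c)) t = transcript_prob 0 t" for t
    unfolding U_def pmf_bind transcript_prob_def expectation_uniform_signs[symmetric]
    by (intro Bochner_Integration.integral_cong refl) (auto simp: pmf_board_dist)
  then have ratio: "channel_ratio U (board_dist c) (x, y) t =
      first_half_prob c t x * second_half_prob c t y / transcript_prob 0 t" for x y t
    by (simp add: channel_ratio_def pmf_board_dist)
  have "measure_pmf.expectation (pair_pmf U (bind_pmf U (board_dist c)))
      (\<lambda>(xy, t). channel_ratio U (board_dist c) xy t * log 2 (channel_ratio U (board_dist c) xy t)) =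
    measure_pmf.expectation U (\<lambda>xy. \<Sum>t\<in>paths (context_tree c).
      pmf (board_dist c xy) t * log 2 (channel_ratio U (board_dist c) xy t))"
    by (rule expectation_channel_ratio) (simp_all add: U_def finite_paths set_board_dist)
  also have "\<dots> = measure_pmf.expectation U (\<lambda>(x, y). divergence x y / ln 2)"
    by (intro Bochner_Integration.integral_cong refl)
      (auto simp: ratio divergence_def pmf_board_dist log_def sum_divide_distrib)
  also have "\<dots> = info / ln 2"
    unfolding U_def expectation_uniform_signs info_def
    using tilt_mean_cmult[of 0 N "1 / ln 2" divergence] by simp
  finally show ?thesis .
qed

lemma transcript_information_eq:
  assumes "4 \<le> k"
  shows "transcript_information k n N P =
    measure_pmf.expectation context_dist (\<lambda>c. context_info c / ln 2)"
  unfolding transcript_information_def expectation_log_channel_ratio[symmetric]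
proof (rule conditional_mutual_information_context[where B = "4 ^ N"])
  show "map_pmf (\<lambda>\<omega>. (case \<omega> of (w, s, r) \<Rightarrow> (Xvar k N w, Yvar k N w), transcript P \<omega>,
      case \<omega> of (w, s, r) \<Rightarrow> (Mvar N w, Dvar n N w))) (execution k n N P) = do {
    c \<leftarrow> context_dist;
    xy \<leftarrow> uniform_signs;
    t \<leftarrow> board_dist c xy;
    return_pmf (xy, (public_coins c, t), context_label c) }"
    using observation_law[OF assms] by (simp add: observation_def[abs_def] case_prod_unfold)
qed (auto simp: inj_on_context_label card_cube simp flip: power_mult_distrib)

lemma expectation_erroneous:
  "measure_pmf.expectation uniform_signs (\<lambda>xy.
     measure_pmf.expectation (board_dist c xy)
       (\<lambda>t. of_bool (erroneous (xy, (public_coins c, t), z)))) =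
   context_error c"
proof -
  interpret two_party "paths (context_tree c)" "first_half_prob c" "second_half_prob c" N
    by (rule two_party_context)
  have "measure_pmf.expectation (board_dist c xy)
        (\<lambda>t. of_bool (erroneous (xy, (public_coins c, t), z))) =
      (case xy of (x, y) \<Rightarrow> cond_error (verdict (context_tree c)) x y)" for xy
    by (subst integral_measure_pmf_real[where A = "paths (context_tree c)"])
      (auto simp: finite_paths subsetD[OF set_board_dist] cond_error_def pmf_board_dist mult.commute
        split: prod.split simp flip: context_tree_def)
  then show ?thesis
    by (simp add: expectation_uniform_signs error_rate_def)
qed

lemma error_prob_eq_expectation:
  assumes "4 \<le> k" "even k" "1 \<le> n" "0 < \<epsilon>" "real N = 1 / \<epsilon>\<^sup>2"
  shows "error_prob \<epsilon> k n N P = measure_pmf.expectation context_dist context_error"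
proof -
  let ?err = "\<lambda>e :: sign_vectors \<times> (nat \<times> bool list) \<times> nat list \<times> nat list list.
    of_bool (erroneous e) :: real"
  have "?err = indicator {e. erroneous e}" by (auto simp: indicator_def fun_eq_iff)
  then have "error_prob \<epsilon> k n N P =
      measure_pmf.expectation (map_pmf observation (execution k n N P)) ?err"
    unfolding error_prob_eq_observation[OF assms] by simp
  also have "\<dots> = measure_pmf.expectation context_dist (\<lambda>c.
      measure_pmf.expectation uniform_signs (\<lambda>xy.
        measure_pmf.expectation (board_dist c xy)
          (\<lambda>t. ?err (xy, (public_coins c, t), context_label c))))"
    unfolding observation_law[OF assms(1)]
    by (simp add: expectation_bind_pmf[where B = 1] flip: map_pmf_def)
  finally show ?thesis by (simp only: expectation_erroneous)
qed

lemma transcript_information_ge: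
  assumes k: "4 \<le> k" "even k" and n: "1 \<le> n" and \<epsilon>: "0 < \<epsilon>" "real N = 1 / \<epsilon>\<^sup>2" and N: "640000 \<le> N"
  defines "\<delta> \<equiv> 1 / (10 ^ 6 * exp 64)"
  shows "real N / (10 ^ 8 * exp 64) * (1 - error_prob \<epsilon> k n N P / \<delta>) \<le>
    transcript_information k n N P"
proof -
  define \<gamma> :: real where "\<gamma> = real N / (10 ^ 8 * exp 64)"
  have error: "0 \<le> context_error c" "context_error c \<le> 1"
    and info: "0 \<le> context_info c" "context_info c \<le> real N * ln 4"
    and info_ge: "\<gamma> * (1 - context_error c / \<delta>) \<le> context_info c" for c
  proof -
    interpret two_party "paths (context_tree c)" "first_half_prob c" "second_half_prob c" N
      by (rule two_party_context)
    show "0 \<le> error_rate 0 (verdict (context_tree c))" "error_rate 0 (verdict (context_tree c)) \<le> 1"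
      by (simp_all add: error_rate_nonneg error_rate_le_1)
    show "0 \<le> info" "info \<le> real N * ln 4" by (rule info_nonneg info_le)+
    show "\<gamma> * (1 - error_rate 0 (verdict (context_tree c)) / \<delta>) \<le> info"
      unfolding \<gamma>_def \<delta>_def by (rule info_ge[OF N])
  qed
  have integrable_error: "integrable context_dist context_error"
    using error by (intro measure_pmf.integrable_const_bound[where B = 1] AE_pmfI) auto
  have integrable_info: "integrable context_dist (\<lambda>c. context_info c / ln 2)"
    using info
    by (intro integrable_divide
        measure_pmf.integrable_const_bound[where B = "real N * ln 4"] AE_pmfI) auto
  have "\<gamma> * (1 - error_prob \<epsilon> k n N P / \<delta>) =
      measure_pmf.expectation context_dist (\<lambda>c. \<gamma> * (1 - context_error c / \<delta>))"
    using integrable_error by (simp add: error_prob_eq_expectation[OF k n \<epsilon>])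
  also have "\<dots> \<le> measure_pmf.expectation context_dist (\<lambda>c. context_info c / ln 2)"
  proof (intro integral_mono integrable_info)
    fix c
    have "context_info c * ln 2 \<le> context_info c"
      using info(1)[of c] ln_2_less_1 by (intro mult_left_le) auto
    then have "context_info c \<le> context_info c / ln 2" by (simp add: field_simps)
    then show "\<gamma> * (1 - context_error c / \<delta>) \<le> context_info c / ln 2"
      using info_ge[of c] by linarith
  qed (use integrable_error in auto)
  finally show ?thesis
    by (simp add: \<gamma>_def transcript_information_eq[OF k(1)])
qed

end

theorem theorem6:
  shows "\<exists>\<delta>>0. \<exists>c>0. \<exists>\<epsilon>\<^sub>0>0. \<forall>(\<epsilon>::real) (N::nat) (k::nat) (n::nat) (P::protocol).
           0 < \<epsilon> \<and> \<epsilon> \<le> \<epsilon>\<^sub>0 \<and> real N = 1 / \<epsilon>\<^sup>2 \<and>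
           (\<exists>p. k = 2 ^ p) \<and> 4 \<le> k \<and> 1 \<le> n \<and>
           blackboard_protocol k P \<and> error_prob \<epsilon> k n N P \<le> \<delta> \<longrightarrow>
           transcript_information k n N P \<ge> c * (1 / \<epsilon>\<^sup>2)"
proof (intro exI conjI allI impI; (elim conjE exE)?)
  fix \<epsilon> :: real and N k n p :: nat and P :: protocol
  assume \<epsilon>: "0 < \<epsilon>" "\<epsilon> \<le> 1 / 800" "real N = 1 / \<epsilon>\<^sup>2" and k: "k = 2 ^ p" "4 \<le> k" and n: "1 \<le> n"
    and error: "error_prob \<epsilon> k n N P \<le> 1 / (10 ^ 6 * exp 64) / 2"
  have "even k" using k by (cases p) auto
  have "1 / (1 / 800)\<^sup>2 \<le> 1 / \<epsilon>\<^sup>2" using \<epsilon> by (intro divide_left_mono power_mono) auto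
  then have N: "640000 \<le> N" using \<epsilon>(3) by (simp add: power2_eq_square)
  have "1 / (2 * (10 ^ 8 * exp 64)) * (1 / \<epsilon>\<^sup>2) = real N / (10 ^ 8 * exp 64) * (1 - 1 / 2)"
    using \<epsilon>(3) by simp
  also have "\<dots> \<le> real N / (10 ^ 8 * exp 64) * (1 - error_prob \<epsilon> k n N P / (1 / (10 ^ 6 * exp 64)))"
    using error by (intro mult_left_mono) (auto simp: field_simps)
  also have "\<dots> \<le> transcript_information k n N P"
    by (rule transcript_information_ge[OF k(2) \<open>even k\<close> n \<epsilon>(1,3) N])
  finally show "1 / (2 * (10 ^ 8 * exp 64)) * (1 / \<epsilon>\<^sup>2) \<le> transcript_information k n N P" .
qed simp_all

end
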